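(* Let $\mathcal{P}=\{f_1,\ldots,f_n\}\subset\mathbb{D}\{U\}$ be a system of linear differential polynomials satisfying the standing assumptions $(\mathcal{P}1)$–$(\mathcal{P}4)$. If $\mathcal{P}$ is not super essential, then the system $\mathcal{P}^*$ is a proper super essential subsystem of $\mathcal{P}$, with $\nu(\mathcal{P}^* )=|\mathcal{P}^*|-1$.
   Context: Let $\mathbb{D}$ be an ordinary differential domain with derivation $\partial$, $n\ge 2$, and $U=\{u_1,\ldots,u_{n-1}\}$ a set of differential indeterminates over $\mathbb{D}$; $\mathbb{D}\{U\}$ is the ring of differential polynomials and $\mathbb{D}[\partial]$ the ring of linear differential operators with coefficients in $\mathbb{D}$. System: $\mathcal{P}=\{f_1,\ldots,f_n\}$ with $f_i=a_i+\sum_{j=1}^{n-1}\mathcal{L}_{i,j}(u_j)$, $a_i\in\mathbb{D}$, $\mathcal{L}_{i,j}\in\mathbb{D}[\partial]$. For a subsystem $\mathcal{P}'\subseteq\mathcal{P}$, $\nu(\mathcal{P}')$ is the number of $j\in\{1,\ldots,n-1\}$ such that $\mathcal{L}_{i,j}\neq 0$ for some $i$ with $f_i\in\mathcal{P}'$. Standing assumptions: $(\mathcal{P}1)$ every $f_i$ has order $\ge 0$ in $U$ (i.e. $f_i\notin\mathbb{D}$); $(\mathcal{P}2)$ the $n$ polynomials are distinct; $(\mathcal{P}3)$ $a_i\neq0$ for some $i$; $(\mathcal{P}4)$ $\nu(\mathcal{P})=n-1$. Super essential: $\mathcal{P}$ is super essential if for every $i\in\{1,\ldots,n\}$ there is a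 permutation $\tau_i$ of $\{1,\ldots,n-1\}$ such that $\mathcal{L}_{j,\tau_i(n-j)}\neq 0$ for $j=1,\ldots,i-1$ and $\mathcal{L}_{j,\tau_i(n-j+1)}\neq 0$ for $j=i+1,\ldots,n$. A subsystem $\mathcal{P}'=\{f_{i_1},\ldots,f_{i_m}\}$ of $\mathcal{P}$ is super essential if there is $J\subset\{1,\ldots,n-1\}$ with $|J|=m-1$ such that $\mathcal{L}_{i_h,j}=0$ for all $h$ and all $j\notin J$, and for every $h\in\{1,\ldots,m\}$ there is a bijection $\eta:\{1,\ldots,m\}\setminus\{h\}\to J$ with $\mathcal{L}_{i_t,\eta(t)}\neq0$ for all $t\neq h$ (i.e. $\mathcal{P}'$ is super essential as a system of $m$ polynomials in the $m-1$ indeterminates $u_j$, $j\in J$). The system $\mathcal{P}^*$: let $x_{i,j}$ be algebraic indeterminates over $\mathbb{Q}$ and $X(\mathcal{P})=(X_{i,j})$ the $n\times(n-1)$ matrix with $X_{i,j}=x_{i,j}$ if $\mathcal{L}_{i,j}\neq0$ and $X_{i,j}=0$ otherwise; let $\mathbb{K}=\mathbb{Q}(X_{i,j}\mid X_{i,j}\neq0)$. In the polynomial ring $\mathbb{K}[c_1,\ldots,c_n,u_1,\ldots,u_{n-1}]$ let $p_i=c_i+\sum_{j=1}^{n-1}X_{i,j}u_j$, $i=1,\ldots,n$, and let $\mathcal{B}=\{e_0<e_1<\cdots<e_{n-1}\}$ be the reduced Gröbner basis of the ideal $(p_1,\ldots,p_n)$ with respect to the lexicographic monomial order with $u_1>\cdots>u_{n-1}>c_1>\cdots>c_n$,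 ordered by increasing leading monomials. Its elements are homogeneous linear forms (the rows of the reduced echelon form of the coefficient matrix of $p_1,\dots,p_n$), and $e_0=\sum_{h=1}^n\chi_hc_h$ with $\chi_h\in\mathbb{K}$ involves only the variables $c_1,\ldots,c_n$. Put $\mathcal{I}(e_0)=\{h\mid\chi_h\neq0\}$ and $\mathcal{P}^*=\{f_h\mid h\in\mathcal{I}(e_0)\}$. *)

theory Defs
  imports
    "HOL-Library.Poly_Mapping"
    "HOL-Computational_Algebra.Polynomial"
    "HOL-Computational_Algebra.Fraction_Field"
    "HOL-Combinatorics.Permutations"
begin

section \<open>Polynomial rings\<close>

text \<open>A monomial over a set of indeterminates \<open>'v\<close> is an element of \<open>'v \<Rightarrow>\<^sub>0 nat\<close>, and
  \<open>('v \<Rightarrow>\<^sub>0 nat) \<Rightarrow>\<^sub>0 'a\<close> with its convolution product is the polynomial ring over \<open>'a\<close>.\<close>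

definition mconst :: "'a::comm_semiring_1 \<Rightarrow> ('v \<Rightarrow>\<^sub>0 nat) \<Rightarrow>\<^sub>0 'a" where
  "mconst c = Poly_Mapping.single 0 c"

definition mvar :: "'v \<Rightarrow> ('v \<Rightarrow>\<^sub>0 nat) \<Rightarrow>\<^sub>0 'a::comm_semiring_1" where
  "mvar v = Poly_Mapping.single (Poly_Mapping.single v 1) 1"

text \<open>\<open>poly_ring A V\<close> is \<open>A[V]\<close> as a subset of the ring of polynomials in all indeterminates.\<close>

definition poly_ring :: "'a::zero set \<Rightarrow> 'v set \<Rightarrow> (('v \<Rightarrow>\<^sub>0 nat) \<Rightarrow>\<^sub>0 'a) set" where
  "poly_ring A V =
     {p. \<forall>m\<in>Poly_Mapping.keys p. Poly_Mapping.lookup p m \<in> A \<and> Poly_Mapping.keys m \<subseteq> V}"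

definition ideal_in :: "'r::comm_ring_1 set \<Rightarrow> 'r set \<Rightarrow> 'r set" where
  "ideal_in R S = {\<Sum>g\<in>F. q g * g | F q. finite F \<and> F \<subseteq> S \<and> (\<forall>g\<in>F. q g \<in> R)}"


section \<open>Differential polynomials and linear differential operators\<close>

definition derivation :: "('r::comm_ring_1 \<Rightarrow> 'r) \<Rightarrow> bool" where
  "derivation d \<longleftrightarrow> (\<forall>x y. d (x + y) = d x + d y \<and> d (x * y) = d x * y + x * d y)"

text \<open>In \<open>\<D>{U}\<close> the indeterminate \<open>(j, k)\<close> is the \<open>k\<close>-th derivative of \<open>u\<^sub>j\<close>.\<close>

type_synonym 'a diffpoly = "(nat \<times> nat \<Rightarrow>\<^sub>0 nat) \<Rightarrow>\<^sub>0 'a"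

text \<open>The extension of a derivation \<open>d\<close> of \<open>\<D>\<close> to \<open>\<D>{U}\<close>: \<open>diff_term d m c\<close> is the derivative of
  the term \<open>c m\<close>, namely \<open>d(c) m + c \<Sum>\<^sub>v (\<partial>m/\<partial>v) v'\<close>, where \<open>v'\<close> is the derivative of the
  indeterminate \<open>v\<close>.\<close>

definition diff_term :: "('a::comm_ring_1 \<Rightarrow> 'a) \<Rightarrow> (nat \<times> nat \<Rightarrow>\<^sub>0 nat) \<Rightarrow> 'a \<Rightarrow> 'a diffpoly" where
  "diff_term d m c = Poly_Mapping.single m (d c) +
     (\<Sum>v\<in>Poly_Mapping.keys m. Poly_Mapping.single
        (m - Poly_Mapping.single v 1 + Poly_Mapping.single (fst v, Suc (snd v)) 1)
        (of_nat (Poly_Mapping.lookup m v) * c))"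

definition diff_ext :: "('a::comm_ring_1 \<Rightarrow> 'a) \<Rightarrow> 'a diffpoly \<Rightarrow> 'a diffpoly" where
  "diff_ext d p = (\<Sum>m\<in>Poly_Mapping.keys p. diff_term d m (Poly_Mapping.lookup p m))"

text \<open>An operator \<open>\<Sum>\<^sub>k b\<^sub>k \<partial>\<^sup>k\<close> in \<open>\<D>[\<partial>]\<close> is given by its coefficient sequence, as an element of
  \<open>'a poly\<close>.  Only the additive structure of \<open>'a poly\<close> is meaningful here: its commutative product
  is not the composition of operators.\<close>

definition op_apply :: "('a::comm_ring_1 \<Rightarrow> 'a) \<Rightarrow> 'a poly \<Rightarrow> 'a diffpoly \<Rightarrow> 'a diffpoly" where
  "op_apply d \<L> p = (\<Sum>k\<le>degree \<L>. mconst (coeff \<L> k) * (diff_ext d ^^ k) p)"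

lemma derivation_0: "derivation d \<Longrightarrow> d 0 = 0"
  unfolding derivation_def by (metis add_cancel_right_left)

lemma derivation_1: "derivation d \<Longrightarrow> d 1 = 0"
  unfolding derivation_def by (metis add_cancel_right_left mult.right_neutral mult_1)

lemma diff_ext_mconst: "derivation d \<Longrightarrow> diff_ext d (mconst c) = mconst (d c)"
  by (cases "c = 0") (auto simp: diff_ext_def diff_term_def mconst_def derivation_0)

lemma diff_ext_mvar: "derivation d \<Longrightarrow> diff_ext d (mvar (j, k)) = mvar (j, Suc k)"
  by (simp add: diff_ext_def diff_term_def mvar_def derivation_1)

lemma diff_term_add:
  "derivation d \<Longrightarrow> diff_term d m (b + c) = diff_term d m b + diff_term d m c"
  by (simp add: diff_term_def derivation_def single_add sum.distrib algebra_simps)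

lemma diff_term_0: "derivation d \<Longrightarrow> diff_term d m 0 = 0"
  by (simp add: diff_term_def derivation_0)

lemma diff_ext_superset:
  assumes "derivation d" "finite M" "Poly_Mapping.keys p \<subseteq> M"
  shows "diff_ext d p = (\<Sum>m\<in>M. diff_term d m (Poly_Mapping.lookup p m))"
  unfolding diff_ext_def
  by (rule sum.mono_neutral_left)
     (use assms in \<open>auto simp: in_keys_iff diff_term_0\<close>)

lemma diff_ext_add:
  assumes "derivation d"
  shows "diff_ext d (p + q) = diff_ext d p + diff_ext d q"
proof -
  let ?M = "Poly_Mapping.keys p \<union> Poly_Mapping.keys q"
  have "Poly_Mapping.keys (p + q) \<subseteq> ?M" by (rule keys_add)
  then show ?thesis
    using assms by (simp add: diff_ext_superset[of d ?M] lookup_add diff_term_add sum.distrib)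
qed

lemma diff_ext_single:
  "derivation d \<Longrightarrow> diff_ext d (Poly_Mapping.single m c) = diff_term d m c"
  by (cases "c = 0") (auto simp: diff_ext_def diff_term_0)

lemma diff_term_superset:
  assumes "finite V" "Poly_Mapping.keys m \<subseteq> V"
  shows "diff_term d m c = Poly_Mapping.single m (d c) +
     (\<Sum>v\<in>V. Poly_Mapping.single
        (m - Poly_Mapping.single v 1 + Poly_Mapping.single (fst v, Suc (snd v)) 1)
        (of_nat (Poly_Mapping.lookup m v) * c))"
  unfolding diff_term_def
  by (rule arg_cong2[where f = plus], rule refl, rule sum.mono_neutral_left)
     (use assms in \<open>auto simp: in_keys_iff\<close>)

lemma monomial_minus_add:
  fixes m m' :: "'v \<Rightarrow>\<^sub>0 nat"
  assumes "Poly_Mapping.lookup m v \<noteq> 0"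
  shows "m + m' - Poly_Mapping.single v 1 = (m - Poly_Mapping.single v 1) + m'"
  by (rule poly_mapping_eqI)
     (use assms in \<open>auto simp: lookup_add lookup_minus lookup_single when_def\<close>)

lemma diff_term_mult:
  assumes d: "derivation d"
  shows "diff_term d (m + m') (b * c) =
     diff_term d m b * Poly_Mapping.single m' c + Poly_Mapping.single m b * diff_term d m' c"
proof -
  let ?V = "Poly_Mapping.keys m \<union> Poly_Mapping.keys m'"
  let ?D = "\<lambda>m v c. Poly_Mapping.single
        (m - Poly_Mapping.single v 1 + Poly_Mapping.single (fst v, Suc (snd v)) 1)
        (of_nat (Poly_Mapping.lookup m v) * c)"
  have *: "?D (m + m') v (b * c) =
      ?D m v b * Poly_Mapping.single m' c + Poly_Mapping.single m b * ?D m' v c" for v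
  proof -
    let ?w = "Poly_Mapping.single (fst v, Suc (snd v)) (1::nat)"
    let ?e = "Poly_Mapping.single v (1::nat)"
    let ?n = "m + m' - ?e + ?w"
    have 1: "?D m v b * Poly_Mapping.single m' c =
        Poly_Mapping.single ?n (of_nat (Poly_Mapping.lookup m v) * (b * c))"
    proof (cases "Poly_Mapping.lookup m v = 0")
      case False
      then show ?thesis
        by (simp only: monomial_minus_add[OF False] mult_single ac_simps)
    qed simp
    have 2: "Poly_Mapping.single m b * ?D m' v c =
        Poly_Mapping.single ?n (of_nat (Poly_Mapping.lookup m' v) * (b * c))"
    proof (cases "Poly_Mapping.lookup m' v = 0")
      case False
      have "?n = m + (m' - ?e + ?w)"
        using monomial_minus_add[OF False, of m] by (simp add: ac_simps)
      then show ?thesis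
        by (simp only: mult_single ac_simps)
    qed simp
    show ?thesis
      unfolding 1 2 by (simp add: lookup_add algebra_simps flip: single_add)
  qed
  have V: "finite ?V" by simp
  have "diff_term d (m + m') (b * c) =
      Poly_Mapping.single (m + m') (d (b * c)) + (\<Sum>v\<in>?V. ?D (m + m') v (b * c))"
    by (rule diff_term_superset[OF V keys_add])
  also have "\<dots> = (Poly_Mapping.single m (d b) + (\<Sum>v\<in>?V. ?D m v b)) * Poly_Mapping.single m' c +
      Poly_Mapping.single m b * (Poly_Mapping.single m' (d c) + (\<Sum>v\<in>?V. ?D m' v c))"
    unfolding * using d
    by (simp add: derivation_def sum.distrib distrib_left distrib_right sum_distrib_left
        sum_distrib_right mult_single single_add ac_simps)
  finally show ?thesis
    by (simp only: diff_term_superset[OF V Un_upper1] diff_term_superset[OF V Un_upper2])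
qed

lemma poly_mapping_single_induct:
  fixes p :: "'k \<Rightarrow>\<^sub>0 'b::comm_monoid_add"
  assumes "P 0" and "\<And>m c p. P p \<Longrightarrow> P (Poly_Mapping.single m c + p)"
  shows "P p"
proof -
  have "P (\<Sum>m\<in>M. Poly_Mapping.single m (Poly_Mapping.lookup p m))" if "finite M" for M
    using that by induction (simp_all add: assms)
  then have "P (\<Sum>m\<in>Poly_Mapping.keys p. Poly_Mapping.single m (Poly_Mapping.lookup p m))" by simp
  moreover have "(\<Sum>m\<in>Poly_Mapping.keys p. Poly_Mapping.single m (Poly_Mapping.lookup p m)) = p"
    by (rule poly_mapping_eqI)
       (auto simp: lookup_sum lookup_single when_def in_keys_iff sum.delta)
  ultimately show ?thesis by metis
qed

lemma derivation_diff_ext: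
  assumes d: "derivation d"
  shows "derivation (diff_ext d)"
proof -
  have 0: "diff_ext d 0 = 0" by (simp add: diff_ext_def)
  have s: "diff_ext d (Poly_Mapping.single m c * q) =
      diff_ext d (Poly_Mapping.single m c) * q + Poly_Mapping.single m c * diff_ext d q" for m c q
    by (induction q rule: poly_mapping_single_induct)
       (simp_all add: 0 distrib_left diff_ext_add[OF d] mult_single diff_ext_single[OF d]
          diff_term_mult[OF d] ac_simps)
  have "diff_ext d (p * q) = diff_ext d p * q + p * diff_ext d q" for p q
    by (induction p rule: poly_mapping_single_induct)
       (simp_all add: 0 s distrib_right diff_ext_add[OF d])
  then show ?thesis
    unfolding derivation_def[of "diff_ext d"] using diff_ext_add[OF d] by blast
qed

lemma op_apply_mvar:
  assumes "derivation d"
  shows "op_apply d \<L> (mvar (j, 0)) = (\<Sum>k\<le>degree \<L>. mconst (coeff \<L> k) * mvar (j, k))"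
proof -
  have "(diff_ext d ^^ k) (mvar (j, 0)) = mvar (j, k)" for k
    by (induction k) (simp_all add: diff_ext_mvar[OF assms])
  then show ?thesis by (simp add: op_apply_def)
qed


section \<open>Linear systems and super essential systems\<close>

text \<open>The system is the set \<open>f ` {1..n}\<close> with \<open>f i = lin_diffpoly d n a L i\<close>, and its subsystems are
  the subsets of that set.\<close>

definition lin_diffpoly ::
    "('a::comm_ring_1 \<Rightarrow> 'a) \<Rightarrow> nat \<Rightarrow> (nat \<Rightarrow> 'a) \<Rightarrow> (nat \<Rightarrow> nat \<Rightarrow> 'a poly) \<Rightarrow> nat \<Rightarrow> 'a diffpoly" where
  "lin_diffpoly d n a L i = mconst (a i) + (\<Sum>j=1..n-1. op_apply d (L i j) (mvar (j, 0)))"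

definition nu :: "nat \<Rightarrow> (nat \<Rightarrow> 'a diffpoly) \<Rightarrow> (nat \<Rightarrow> nat \<Rightarrow> 'a::comm_ring_1 poly) \<Rightarrow>
    'a diffpoly set \<Rightarrow> nat" where
  "nu n f L Q = card {j\<in>{1..n-1}. \<exists>i\<in>{1..n}. f i \<in> Q \<and> L i j \<noteq> 0}"

definition super_essential :: "nat \<Rightarrow> (nat \<Rightarrow> nat \<Rightarrow> 'a::comm_ring_1 poly) \<Rightarrow> bool" where
  "super_essential n L \<longleftrightarrow> (\<forall>i\<in>{1..n}. \<exists>\<tau>. \<tau> permutes {1..n-1} \<and>
     (\<forall>j\<in>{1..<i}. L j (\<tau> (n - j)) \<noteq> 0) \<and> (\<forall>j\<in>{i+1..n}. L j (\<tau> (n - j + 1)) \<noteq> 0))"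

text \<open>Writing \<open>card Q = card J + 1\<close> rather than \<open>card J = card Q - 1\<close> excludes \<open>Q = {}\<close>.\<close>

definition super_essential_subsystem :: "nat \<Rightarrow> (nat \<Rightarrow> 'a diffpoly) \<Rightarrow>
    (nat \<Rightarrow> nat \<Rightarrow> 'a::comm_ring_1 poly) \<Rightarrow> 'a diffpoly set \<Rightarrow> bool" where
  "super_essential_subsystem n f L Q \<longleftrightarrow> Q \<subseteq> f ` {1..n} \<and>
     (let H = {i\<in>{1..n}. f i \<in> Q} in
      \<exists>J\<subseteq>{1..n-1}. card Q = card J + 1 \<and>
        (\<forall>h\<in>H. \<forall>j\<in>{1..n-1} - J. L h j = 0) \<and>
        (\<forall>h\<in>H. \<exists>\<eta>. bij_betw \<eta> (H - {h}) J \<and> (\<forall>t\<in>H - {h}. L t (\<eta> t) \<noteq> 0)))"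


section \<open>Reduced Groebner bases\<close>

text \<open>On \<open>'v \<Rightarrow>\<^sub>0 nat\<close> with \<open>'v\<close> linearly ordered, the library order \<open><\<close> is the lexicographic monomial
  order in which the \<^emph>\<open>least\<close> element of \<open>'v\<close> is the \<^emph>\<open>largest\<close> indeterminate.\<close>

lemma monomial_less_iff:
  fixes m m' :: "'v::linorder \<Rightarrow>\<^sub>0 nat"
  shows "m < m' \<longleftrightarrow> (\<exists>v. Poly_Mapping.lookup m v < Poly_Mapping.lookup m' v \<and>
    (\<forall>w<v. Poly_Mapping.lookup m w = Poly_Mapping.lookup m' w))"
  by transfer (simp add: less_fun_def)

definition lead_mon :: "(('v::linorder \<Rightarrow>\<^sub>0 nat) \<Rightarrow>\<^sub>0 'a::zero) \<Rightarrow> 'v \<Rightarrow>\<^sub>0 nat" where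
  "lead_mon p = Max (Poly_Mapping.keys p)"

definition mono_dvd :: "('v \<Rightarrow>\<^sub>0 nat) \<Rightarrow> ('v \<Rightarrow>\<^sub>0 nat) \<Rightarrow> bool" where
  "mono_dvd m m' \<longleftrightarrow> (\<exists>k. m' = m + k)"

definition is_groebner_basis ::
    "(('v::linorder \<Rightarrow>\<^sub>0 nat) \<Rightarrow>\<^sub>0 'a::field) set \<Rightarrow> (('v \<Rightarrow>\<^sub>0 nat) \<Rightarrow>\<^sub>0 'a) set \<Rightarrow> bool" where
  "is_groebner_basis I G \<longleftrightarrow> finite G \<and> G \<subseteq> I - {0} \<and>
     (\<forall>p\<in>I - {0}. \<exists>g\<in>G. mono_dvd (lead_mon g) (lead_mon p))"

definition is_reduced_groebner_basis ::
    "(('v::linorder \<Rightarrow>\<^sub>0 nat) \<Rightarrow>\<^sub>0 'a::field) set \<Rightarrow> (('v \<Rightarrow>\<^sub>0 nat) \<Rightarrow>\<^sub>0 'a) set \<Rightarrow> bool" where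
  "is_reduced_groebner_basis I G \<longleftrightarrow> is_groebner_basis I G \<and>
     (\<forall>g\<in>G. Poly_Mapping.lookup g (lead_mon g) = 1) \<and>
     (\<forall>g\<in>G. \<forall>h\<in>G - {g}. \<forall>m\<in>Poly_Mapping.keys g. \<not> mono_dvd (lead_mon h) m)"

definition reduced_groebner_basis ::
    "(('v::linorder \<Rightarrow>\<^sub>0 nat) \<Rightarrow>\<^sub>0 'a::field) set \<Rightarrow> (('v \<Rightarrow>\<^sub>0 nat) \<Rightarrow>\<^sub>0 'a) set" where
  "reduced_groebner_basis I = (THE G. is_reduced_groebner_basis I G)"


section \<open>The system \<open>\<P>\<^sup>*\<close>\<close>

text \<open>The indeterminates \<open>x\<^sub>i\<^sub>,\<^sub>j\<close>.  Their order plays no role; it is only needed for the polynomial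
  ring over \<open>rat\<close> to be an instance of \<open>idom\<close>.\<close>

datatype xvar = XVar nat nat

instantiation xvar :: linorder
begin

fun less_eq_xvar :: "xvar \<Rightarrow> xvar \<Rightarrow> bool" where
  "XVar i j \<le> XVar i' j' \<longleftrightarrow> i < i' \<or> i = i' \<and> j \<le> j'"

definition less_xvar :: "xvar \<Rightarrow> xvar \<Rightarrow> bool" where
  "less_xvar x y \<longleftrightarrow> x \<le> y \<and> \<not> y \<le> x"

instance
proof
  fix x y z :: xvar
  show "x < y \<longleftrightarrow> x \<le> y \<and> \<not> y \<le> x" by (rule less_xvar_def)
  show "x \<le> x" "x \<le> y \<or> y \<le> x" by (cases x; cases y; auto)+
  show "x \<le> y \<Longrightarrow> y \<le> z \<Longrightarrow> x \<le> z" by (cases x; cases y; cases z; auto)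
  show "x \<le> y \<Longrightarrow> y \<le> x \<Longrightarrow> x = y" by (cases x; cases y; auto)
qed

end

text \<open>The indeterminates \<open>u\<^sub>j\<close> and \<open>c\<^sub>i\<close>.  As an order on indices
  \<open>u\<^sub>1 < u\<^sub>2 < \<dots> < c\<^sub>1 < c\<^sub>2 < \<dots>\<close>, so that, as monomials, \<open>u\<^sub>1 > u\<^sub>2 > \<dots> > c\<^sub>1 > c\<^sub>2 > \<dots>\<close>.\<close>

datatype ucvar = UVar nat | CVar nat

instantiation ucvar :: linorder
begin

fun less_eq_ucvar :: "ucvar \<Rightarrow> ucvar \<Rightarrow> bool" where
  "UVar i \<le> UVar j \<longleftrightarrow> i \<le> j"
| "CVar i \<le> CVar j \<longleftrightarrow> i \<le> j"
| "UVar i \<le> CVar j \<longleftrightarrow> True"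
| "CVar i \<le> UVar j \<longleftrightarrow> False"

definition less_ucvar :: "ucvar \<Rightarrow> ucvar \<Rightarrow> bool" where
  "less_ucvar x y \<longleftrightarrow> x \<le> y \<and> \<not> y \<le> x"

instance
proof
  fix x y z :: ucvar
  show "x < y \<longleftrightarrow> x \<le> y \<and> \<not> y \<le> x" by (rule less_ucvar_def)
  show "x \<le> x" "x \<le> y \<or> y \<le> x" by (cases x; cases y; auto)+
  show "x \<le> y \<Longrightarrow> y \<le> z \<Longrightarrow> x \<le> z" by (cases x; cases y; cases z; auto)
  show "x \<le> y \<Longrightarrow> y \<le> x \<Longrightarrow> x = y" by (cases x; cases y; auto)
qed

end

lemma ucvar_monomial_order:
  fixes v w :: ucvar
  shows "Poly_Mapping.single v (1::nat) > Poly_Mapping.single w 1 \<longleftrightarrow> v < w"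
proof -
  have lt: "Poly_Mapping.single w (1::nat) < Poly_Mapping.single v 1" if "v < w" for v w :: ucvar
    unfolding monomial_less_iff
    by (rule exI[of _ v]) (use that in \<open>auto simp: lookup_single when_def\<close>)
  show ?thesis
    using lt[of v w] lt[of w v] by (metis less_asym linorder_neq_iff)
qed

type_synonym ratfun = "((xvar \<Rightarrow>\<^sub>0 nat) \<Rightarrow>\<^sub>0 rat) fract"

definition X_entry :: "(nat \<Rightarrow> nat \<Rightarrow> 'a::comm_ring_1 poly) \<Rightarrow> nat \<Rightarrow> nat \<Rightarrow> ratfun" where
  "X_entry L i j = (if L i j \<noteq> 0 then Fract (mvar (XVar i j)) 1 else 0)"

text \<open>The field \<open>\<K>\<close>, as a subfield of the field of rational functions in all \<open>x\<^sub>i\<^sub>,\<^sub>j\<close>.\<close>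

definition coeff_field :: "nat \<Rightarrow> (nat \<Rightarrow> nat \<Rightarrow> 'a::comm_ring_1 poly) \<Rightarrow> ratfun set" where
  "coeff_field n L =
     (let R = poly_ring UNIV {XVar i j | i j. i \<in> {1..n} \<and> j \<in> {1..n-1} \<and> L i j \<noteq> 0}
      in {Fract p q | p q. p \<in> R \<and> q \<in> R \<and> q \<noteq> 0})"

definition generic_poly ::
    "nat \<Rightarrow> (nat \<Rightarrow> nat \<Rightarrow> 'a::comm_ring_1 poly) \<Rightarrow> nat \<Rightarrow> (ucvar \<Rightarrow>\<^sub>0 nat) \<Rightarrow>\<^sub>0 ratfun" where
  "generic_poly n L i = mvar (CVar i) + (\<Sum>j=1..n-1. mconst (X_entry L i j) * mvar (UVar j))"

definition generic_ideal ::
    "nat \<Rightarrow> (nat \<Rightarrow> nat \<Rightarrow> 'a::comm_ring_1 poly) \<Rightarrow> ((ucvar \<Rightarrow>\<^sub>0 nat) \<Rightarrow>\<^sub>0 ratfun) set" where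
  "generic_ideal n L =
     ideal_in (poly_ring (coeff_field n L) (CVar ` {1..n} \<union> UVar ` {1..n-1}))
              (generic_poly n L ` {1..n})"

definition e0 ::
    "nat \<Rightarrow> (nat \<Rightarrow> nat \<Rightarrow> 'a::comm_ring_1 poly) \<Rightarrow> (ucvar \<Rightarrow>\<^sub>0 nat) \<Rightarrow>\<^sub>0 ratfun" where
  "e0 n L = arg_min_on lead_mon (reduced_groebner_basis (generic_ideal n L))"

definition support_e0 :: "nat \<Rightarrow> (nat \<Rightarrow> nat \<Rightarrow> 'a::comm_ring_1 poly) \<Rightarrow> nat set" where
  "support_e0 n L = {h\<in>{1..n}. Poly_Mapping.lookup (e0 n L) (Poly_Mapping.single (CVar h) 1) \<noteq> 0}"

definition P_star :: "nat \<Rightarrow> (nat \<Rightarrow> 'a diffpoly) \<Rightarrow> (nat \<Rightarrow> nat \<Rightarrow> 'a::comm_ring_1 poly) \<Rightarrow>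
    'a diffpoly set" where
  "P_star n f L = f ` support_e0 n L"

end

theory Submission
  imports Defs
begin

text \<open>The coefficient vector of \<open>e\<^sub>0\<close> spans the linear relations supported on
  \<open>S = \<I>(e\<^sub>0)\<close> between the rows of \<open>X(\<P>)\<close>, and no proper subset of these rows is dependent.
  If some set \<open>T\<close> of rows had fewer than \<open>|T|\<close> columns with nonzero entries, it would be dependent;
  so by Hall's theorem every \<open>S - {h}\<close> can be matched into the columns.  The entries being
  algebraically independent, a matching of all of \<open>S\<close> would make its rows independent; so by Hall
  again exactly \<open>|S| - 1\<close> columns meet \<open>S\<close>, which is super essentiality.  Were \<open>S\<close> all of
  \<open>{1..n}\<close>, the whole system would be super essential.\<close>

section \<open>Matchings and underdetermined systems\<close>

text \<open>The coefficients \<chi> are reached through \<open>THE\<close> and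
  \<open>arg_min_on\<close>, so nothing can be read off \<open>e0\<close> before the reduced
  Groebner basis is shown to exist, to be unique and to consist of echelon rows. The obstacle is
  that the ideal also contains non-linear polynomials, whose leading monomials have to be
  controlled: a substitution homomorphism that kills the ideal takes the place of S-polynomials. All
  coefficients must stay in \<K>, a proper subset of the field \<open>ratfun\<close>, so the linear
  algebra is done relative to a subfield given as a set. Pivots are defined as the leading variables
  of row space vectors, which avoids matrices and row operations on the whole system. Minimality of
  the support then results from comparing a competing relation with the echelon row of the last
  pivot.\<close>

lemma hall_marriage:
  assumes "finite I" and "\<And>i. i \<in> I \<Longrightarrow> finite (A i)"
    and "\<And>T. T \<subseteq> I \<Longrightarrow> card T \<le> card (\<Union>(A ` T))"
  shows "\<exists>\<eta>. inj_on \<eta> I \<and> (\<forall>i\<in>I. \<eta> i \<in> A i)"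
  using assms
proof (induction I arbitrary: A rule: finite_psubset_induct)
  case (psubset I)
  show ?case
  \<comment> \<open>Halmos-Vaughan dichotomy: either a proper nonempty set \<open>T\<close> is
    tight, and \<open>T\<close> and \<open>I - T\<close> can be matched separately, or every such
    set has a neighbour to spare, and one arbitrary choice does no harm.\<close>
  proof (cases "\<exists>T. T \<subset> I \<and> T \<noteq> {} \<and> card (\<Union>(A ` T)) = card T")
    case True
    then obtain T where T: "T \<subset> I" "T \<noteq> {}" "card (\<Union>(A ` T)) = card T" by blast
    have finT: "finite T" using T psubset.hyps finite_subset by blast
    have fT: "finite (\<Union>(A ` T))" using finT T psubset.prems(1) by blast
    have "\<exists>\<eta>. inj_on \<eta> T \<and> (\<forall>i\<in>T. \<eta> i \<in> A i)"
      using T(1) psubset.prems by (intro psubset.IH) auto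
    then obtain \<eta>1 where \<eta>1: "inj_on \<eta>1 T" "\<forall>i\<in>T. \<eta>1 i \<in> A i" by blast
    let ?B = "\<lambda>i. A i - \<Union>(A ` T)"
    have "\<exists>\<eta>. inj_on \<eta> (I - T) \<and> (\<forall>i\<in>I - T. \<eta> i \<in> ?B i)"
    proof (rule psubset.IH)
      show "I - T \<subset> I" using T by blast
      show "finite (?B i)" if "i \<in> I - T" for i using that psubset.prems(1) by blast
      fix U assume U: "U \<subseteq> I - T"
      have finU: "finite U" using U psubset.hyps finite_subset by blast
      \<comment> \<open>Hall's condition for the remainder comes from counting the neighbours of
        \<open>U \<union> T\<close> and discarding those of \<open>T\<close>, of which there are
        exactly \<open>card T\<close>.\<close>
      have eq: "\<Union>(?B ` U) = \<Union>(A ` (U \<union> T)) - \<Union>(A ` T)" by blast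
      have "card U + card T = card (U \<union> T)"
        using U finU finT by (intro card_Un_disjoint[symmetric]) auto
      also have "\<dots> \<le> card (\<Union>(A ` (U \<union> T)))"
        using U T by (intro psubset.prems) auto
      also have "\<dots> = card (\<Union>(?B ` U)) + card (\<Union>(A ` T))"
      proof -
        have "finite (\<Union>(A ` (U \<union> T)))"
          using finU finT U T psubset.prems(1) by blast
        moreover have "\<Union>(A ` T) \<subseteq> \<Union>(A ` (U \<union> T))" by blast
        ultimately show ?thesis
          unfolding eq by (simp add: card_Diff_subset[OF fT] card_mono)
      qed
      finally show "card U \<le> card (\<Union>(?B ` U))" using T(3) by simp
    qed
    then obtain \<eta>2 where \<eta>2: "inj_on \<eta>2 (I - T)" "\<forall>i\<in>I - T. \<eta>2 i \<in> ?B i"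
      by (elim exE conjE)
    let ?\<eta> = "\<lambda>i. if i \<in> T then \<eta>1 i else \<eta>2 i"
    have ne: "\<eta>1 x \<noteq> \<eta>2 y" if "x \<in> T" "y \<in> I - T" for x y
    proof
      assume "\<eta>1 x = \<eta>2 y"
      then have "\<eta>2 y \<in> \<Union>(A ` T)" using \<eta>1(2) that(1) by (metis UN_I)
      with bspec[OF \<eta>2(2) that(2)] show False by simp
    qed
    have "inj_on ?\<eta> I"
    proof (rule inj_onI)
      fix x y assume xy: "x \<in> I" "y \<in> I" "?\<eta> x = ?\<eta> y"
      show "x = y"
        using xy ne[of x y] ne[of y x] inj_onD[OF \<eta>1(1), of x y] inj_onD[OF \<eta>2(1), of x y]
        by (simp split: if_splits)
    qed
    moreover have "\<forall>i\<in>I. ?\<eta> i \<in> A i" using \<eta>1 \<eta>2 by auto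
    ultimately show ?thesis by (intro exI[of _ ?\<eta>] conjI)
  next
    case False
    show ?thesis
    proof (cases "I = {}")
      case True
      then show ?thesis by simp
    next
      case ne: False
      then obtain i where i: "i \<in> I" by blast
      have "card {i} \<le> card (A i)" using psubset.prems(2)[of "{i}"] i by simp
      then obtain x where x: "x \<in> A i" by fastforce
      have "\<exists>\<eta>. inj_on \<eta> (I - {i}) \<and> (\<forall>k\<in>I - {i}. \<eta> k \<in> A k - {x})"
      proof (rule psubset.IH)
        show "I - {i} \<subset> I" using i by blast
        show "finite (A k - {x})" if "k \<in> I - {i}" for k using that psubset.prems(1) by blast
        fix U assume U: "U \<subseteq> I - {i}"
        show "card U \<le> card (\<Union>((\<lambda>k. A k - {x}) ` U))"
        proof (cases "U = {}")
          case nonempty: False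
          \<comment> \<open>Here \<open>U\<close> is nonempty and proper in \<open>I\<close>, hence
            not tight, and can afford to lose \<open>x\<close>.\<close>
          have "card (\<Union>(A ` U)) \<noteq> card U" using False U i nonempty by blast
          moreover have "card U \<le> card (\<Union>(A ` U))" using U by (intro psubset.prems) auto
          moreover have "(\<Union>((\<lambda>k. A k - {x}) ` U)) = \<Union>(A ` U) - {x}" by blast
          ultimately show ?thesis by (auto simp: card_Diff_singleton_if)
        qed simp
      qed
      then obtain \<eta> where \<eta>: "inj_on \<eta> (I - {i})" "\<forall>k\<in>I - {i}. \<eta> k \<in> A k - {x}" by blast
      have "inj_on (\<eta>(i := x)) I"
        using \<eta> by (auto simp: inj_on_def)
      moreover have "\<forall>k\<in>I. (\<eta>(i := x)) k \<in> A k" using \<eta> x by auto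
      ultimately show ?thesis by blast
    qed
  qed
qed

section \<open>Linear algebra over a subfield\<close>

locale subfield =
  fixes K :: "'a::field set"
  assumes one_closed: "1 \<in> K"
    and diff_closed: "x \<in> K \<Longrightarrow> y \<in> K \<Longrightarrow> x - y \<in> K"
    and mult_closed: "x \<in> K \<Longrightarrow> y \<in> K \<Longrightarrow> x * y \<in> K"
    and inverse_closed: "x \<in> K \<Longrightarrow> inverse x \<in> K"
begin

lemma zero_closed: "0 \<in> K"
  using diff_closed[OF one_closed one_closed] by simp

lemma uminus_closed: "x \<in> K \<Longrightarrow> - x \<in> K"
  using diff_closed[OF zero_closed] by fastforce

lemma add_closed: "x \<in> K \<Longrightarrow> y \<in> K \<Longrightarrow> x + y \<in> K"
  using diff_closed[OF _ uminus_closed] by fastforce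

lemma divide_closed: "x \<in> K \<Longrightarrow> y \<in> K \<Longrightarrow> x / y \<in> K"
  by (simp add: divide_inverse mult_closed inverse_closed)

lemma sum_closed: "(\<And>i. i \<in> A \<Longrightarrow> g i \<in> K) \<Longrightarrow> sum g A \<in> K"
  by (induction A rule: infinite_finite_induct) (auto simp: zero_closed add_closed)

lemmas closed = one_closed zero_closed diff_closed mult_closed inverse_closed uminus_closed
  add_closed divide_closed

text \<open>Gaussian elimination, by induction on the columns. The solution is kept in
  \<open>K\<close> and set to zero outside \<open>T\<close>, so that it can be read as a relation
  among all rows of a larger system.\<close>

lemma underdetermined_system:
  assumes "finite C" "finite T" "card C < card T"
    and "\<And>i j. i \<in> T \<Longrightarrow> j \<in> C \<Longrightarrow> X i j \<in> K"
  shows "\<exists>k. (\<forall>i. k i \<in> K) \<and> (\<forall>i. i \<notin> T \<longrightarrow> k i = 0) \<and> (\<exists>i. k i \<noteq> 0) \<and>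
    (\<forall>j\<in>C. (\<Sum>i\<in>T. k i * X i j) = 0)"
  using assms
proof (induction C arbitrary: T X rule: finite_induct)
  case empty
  then obtain i where "i \<in> T" by fastforce
  then show ?case
    by (intro exI[of _ "\<lambda>t. if t = i then 1 else 0"]) (auto simp: closed)
next
  case (insert j C)
  show ?case
  proof (cases "\<forall>i\<in>T. X i j = 0")
    case True
    have "\<exists>k. (\<forall>i. k i \<in> K) \<and> (\<forall>i. i \<notin> T \<longrightarrow> k i = 0) \<and> (\<exists>i. k i \<noteq> 0) \<and>
      (\<forall>j\<in>C. (\<Sum>i\<in>T. k i * X i j) = 0)"
      using insert by (intro insert.IH) auto
    then obtain k where k: "\<And>i. k i \<in> K" "\<And>i. i \<notin> T \<Longrightarrow> k i = 0" "\<exists>i. k i \<noteq> 0"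
      "\<And>l. l \<in> C \<Longrightarrow> (\<Sum>i\<in>T. k i * X i l) = 0" by blast
    moreover have "(\<Sum>i\<in>T. k i * X i j) = 0" using True by (intro sum.neutral) auto
    ultimately show ?thesis by (intro exI[of _ k]) simp
  next
    case False
    then obtain r where r: "r \<in> T" "X r j \<noteq> 0" by blast
    \<comment> \<open>Subtracting multiples of row \<open>r\<close> clears column \<open>j\<close>,
      so the other rows form a system with one column and one row fewer.\<close>
    let ?Y = "\<lambda>i l. X i l - X i j / X r j * X r l"
    have "\<exists>k. (\<forall>i. k i \<in> K) \<and> (\<forall>i. i \<notin> T - {r} \<longrightarrow> k i = 0) \<and> (\<exists>i. k i \<noteq> 0) \<and>
      (\<forall>l\<in>C. (\<Sum>i\<in>T - {r}. k i * ?Y i l) = 0)"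
      using insert r by (intro insert.IH) (auto simp: closed)
    then obtain k where k: "\<And>i. k i \<in> K" "\<And>i. i \<notin> T - {r} \<Longrightarrow> k i = 0" "\<exists>i. k i \<noteq> 0"
      "\<And>l. l \<in> C \<Longrightarrow> (\<Sum>i\<in>T - {r}. k i * ?Y i l) = 0" by blast
    \<comment> \<open>The coefficient of row \<open>r\<close> collects the multiples that were
      subtracted: this turns a relation among the rows \<open>?Y\<close> into one among the rows
      \<open>X\<close>.\<close>
    let ?s = "(\<Sum>i\<in>T - {r}. k i * X i j) / X r j"
    let ?k = "k(r := - ?s)"
    have split: "(\<Sum>i\<in>T. ?k i * X i l) = - ?s * X r l + (\<Sum>i\<in>T - {r}. k i * X i l)" for l
      using insert.prems r by (subst sum.remove[of _ r]) auto
    have "(\<Sum>i\<in>T. ?k i * X i l) = 0" if "l \<in> insert j C" for l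
    proof (cases "l = j")
      case True
      then show ?thesis unfolding split using r by simp
    next
      case False
      with that have "(\<Sum>i\<in>T - {r}. k i * ?Y i l) = 0" using k by blast
      moreover have "(\<Sum>i\<in>T - {r}. k i * ?Y i l) =
          (\<Sum>i\<in>T - {r}. k i * X i l) - ?s * X r l"
        by (simp add: sum_distrib_right sum_divide_distrib sum_subtractf[symmetric]
            right_diff_distrib mult.assoc)
      ultimately show ?thesis unfolding split by simp
    qed
    moreover have "?s \<in> K"
      using k insert.prems r by (intro closed sum_closed) auto
    then have "?k i \<in> K" for i using k by (auto simp: closed)
    moreover have "\<exists>i. ?k i \<noteq> 0"
      using k(2,3) by (metis DiffD2 fun_upd_other insertI1)
    moreover have "?k i = 0" if "i \<notin> T" for i using that r k(2) by auto
    ultimately show ?thesis by blast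
  qed
qed

end

section \<open>Genericity\<close>

lemma lookup_mult_monomial:
  fixes p :: "('v \<Rightarrow>\<^sub>0 nat) \<Rightarrow>\<^sub>0 'a::comm_semiring_1"
  shows "Poly_Mapping.lookup (p * Poly_Mapping.single m 1) (m' + m) = Poly_Mapping.lookup p m'"
  by (induction p rule: poly_mapping_single_induct)
     (auto simp: distrib_right lookup_add mult_single lookup_single when_def)

text \<open>Compare degrees in the matched indeterminates: in the column matched to a row of maximal
  degree, the diagonal term has strictly larger degree than all other terms.\<close>

lemma matched_rows_independent_poly:
  fixes p :: "nat \<Rightarrow> (xvar \<Rightarrow>\<^sub>0 nat) \<Rightarrow>\<^sub>0 rat" and E :: "nat \<Rightarrow> nat \<Rightarrow> bool"
  assumes "finite S" "inj_on \<eta> S" and E: "\<And>t. t \<in> S \<Longrightarrow> E t (\<eta> t)"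
    and col: "\<And>j. j \<in> \<eta> ` S \<Longrightarrow> (\<Sum>i\<in>S. p i * (if E i j then mvar (XVar i j) else 0)) = 0"
  shows "\<forall>i\<in>S. p i = 0"
proof (rule ccontr)
  assume "\<not> (\<forall>i\<in>S. p i = 0)"
  define wt where "wt m = (\<Sum>t\<in>S. Poly_Mapping.lookup m (XVar t (\<eta> t)))" for m :: "xvar \<Rightarrow>\<^sub>0 nat"
  have wt_add: "wt (m + m') = wt m + wt m'" for m m'
    by (simp add: wt_def lookup_add sum.distrib)
  let ?M = "\<Union>i\<in>S. Poly_Mapping.keys (p i)"
  have "finite ?M" using assms(1) by simp
  moreover have "?M \<noteq> {}" using \<open>\<not> (\<forall>i\<in>S. p i = 0)\<close> by auto
  ultimately have "Max (wt ` ?M) \<in> wt ` ?M" by (intro Max_in) auto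
  then obtain m where m: "m \<in> ?M" "Max (wt ` ?M) = wt m" by (elim imageE)
  have max: "wt m' \<le> wt m" if "m' \<in> ?M" for m'
    unfolding m(2)[symmetric] using \<open>finite ?M\<close> that by (intro Max_ge) auto
  from m(1) obtain r where r: "r \<in> S" "m \<in> Poly_Mapping.keys (p r)" by blast
  let ?x = "Poly_Mapping.single (XVar r (\<eta> r)) (1::nat)"
  let ?Y = "\<lambda>i. if E i (\<eta> r) then mvar (XVar i (\<eta> r)) else 0"
  have "0 = Poly_Mapping.lookup (\<Sum>i\<in>S. p i * ?Y i) (m + ?x)" using col[of "\<eta> r"] r by simp
  also have "\<dots> = Poly_Mapping.lookup (p r * ?Y r) (m + ?x) +
      (\<Sum>i\<in>S - {r}. Poly_Mapping.lookup (p i * ?Y i) (m + ?x))"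
    unfolding lookup_sum by (rule sum.remove) (use assms r in auto)
  also have "Poly_Mapping.lookup (p r * ?Y r) (m + ?x) = Poly_Mapping.lookup (p r) m"
    using E r by (simp add: mvar_def lookup_mult_monomial)
  \<comment> \<open>The column sum is zero while row \<open>r\<close> contributes a nonzero
    coefficient at \<open>m + ?x\<close>, so some other row must contribute there too.\<close>
  finally have "(\<Sum>i\<in>S - {r}. Poly_Mapping.lookup (p i * ?Y i) (m + ?x)) \<noteq> 0"
    using r by (auto simp: in_keys_iff)
  then obtain i where i: "i \<in> S - {r}" "Poly_Mapping.lookup (p i * ?Y i) (m + ?x) \<noteq> 0"
    by (meson sum.neutral)
  let ?y = "Poly_Mapping.single (XVar i (\<eta> r)) (1::nat)"
  have Ei: "E i (\<eta> r)" using i(2) by (auto split: if_splits)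
  have "m + ?x \<in> Poly_Mapping.keys (p i * Poly_Mapping.single ?y 1)"
    using i Ei by (simp add: in_keys_iff mvar_def)
  then obtain m' where m': "m' \<in> Poly_Mapping.keys (p i)" "m + ?x = m' + ?y"
    using keys_mult[of "p i" "Poly_Mapping.single ?y 1"] by auto
  have "wt ?x = 1"
    unfolding wt_def using assms(1) r by (subst sum.remove[of _ r]) (auto simp: lookup_single when_def)
  moreover have "wt ?y = 0"
  proof -
    \<comment> \<open>If \<open>XVar i (\<eta> r)\<close> were a matched indeterminate, injectivity
      of \<eta> would force \<open>i = r\<close>.\<close>
    have "\<not> (i = t \<and> \<eta> r = \<eta> t)" if "t \<in> S" for t
      using i r inj_onD[OF assms(2)] by blast
    then show ?thesis unfolding wt_def by (intro sum.neutral) (simp add: lookup_single when_def)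
  qed
  ultimately have "wt m' = wt m + 1" using arg_cong[OF m'(2), of wt] by (simp add: wt_add)
  moreover have "wt m' \<le> wt m" using m' i max by blast
  ultimately show False by simp
qed

section \<open>Clearing denominators\<close>

lemma common_denominator:
  fixes c :: "'i \<Rightarrow> 'a::idom fract"
  assumes "finite S"
  shows "\<exists>q p. q \<noteq> 0 \<and> (\<forall>i\<in>S. c i * Fract q 1 = Fract (p i) 1)"
  using assms
proof (induction S)
  case empty
  then show ?case by (auto intro: exI[of _ 1])
next
  case (insert r S)
  then obtain q p where qp: "q \<noteq> 0" "\<forall>i\<in>S. c i * Fract q 1 = Fract (p i) 1" by blast
  obtain s t where st: "c r = Fract s t" "t \<noteq> 0" by (rule Fract_cases)
  have "c i * Fract (t * q) 1 = Fract (((\<lambda>i. t * p i)(r := s * q)) i) 1" if "i \<in> insert r S" for i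
  proof (cases "i = r")
    case True
    then show ?thesis using st by (simp add: eq_fract)
  next
    case False
    with that have "c i * Fract q 1 = Fract (p i) 1" using qp by blast
    then have "Fract t 1 * (c i * Fract q 1) = Fract t 1 * Fract (p i) 1" by simp
    then have "c i * (Fract t 1 * Fract q 1) = Fract t 1 * Fract (p i) 1" by (simp only: ac_simps)
    with False show ?thesis by simp
  qed
  moreover have "t * q \<noteq> 0" using st qp by simp
  ultimately show ?case by blast
qed

lemma Fract_sum: "Fract (\<Sum>i\<in>S. g i) 1 = (\<Sum>i\<in>S. Fract (g i) 1)"
proof (induction S rule: infinite_finite_induct)
  case (insert x F)
  have "Fract (g x + sum g F) 1 = Fract (g x) 1 + Fract (sum g F) 1" by simp
  with insert show ?case by simp
qed (simp_all add: Zero_fract_def)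

text \<open>Multiplying by a common denominator reduces this to polynomial coefficients.
  Independence holds over the whole field of rational functions, and so in particular over
  \<K>.\<close>

lemma matched_rows_independent:
  fixes c :: "nat \<Rightarrow> ratfun"
  assumes "finite S" "inj_on \<eta> S" "\<And>t. t \<in> S \<Longrightarrow> L t (\<eta> t) \<noteq> 0"
    and col: "\<And>j. j \<in> \<eta> ` S \<Longrightarrow> (\<Sum>i\<in>S. c i * X_entry L i j) = 0"
  shows "\<forall>i\<in>S. c i = 0"
proof -
  obtain q p where q: "q \<noteq> 0" and p: "\<forall>i\<in>S. c i * Fract q 1 = Fract (p i) 1"
    using common_denominator[OF assms(1)] by blast
  have X: "X_entry L i j = Fract (if L i j \<noteq> 0 then mvar (XVar i j) else 0) 1" for i j
    by (simp add: X_entry_def Zero_fract_def)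
  have "\<forall>i\<in>S. p i = 0"
  proof (rule matched_rows_independent_poly[OF assms(1,2)])
    fix j assume j: "j \<in> \<eta> ` S"
    let ?Y = "\<lambda>i. if L i j \<noteq> 0 then mvar (XVar i j) else 0"
    have "Fract (\<Sum>i\<in>S. p i * ?Y i) 1 = (\<Sum>i\<in>S. Fract (p i) 1 * Fract (?Y i) 1)"
      by (simp add: Fract_sum)
    also have "\<dots> = (\<Sum>i\<in>S. c i * Fract q 1 * X_entry L i j)"
      using p by (simp add: X)
    also have "\<dots> = Fract q 1 * (\<Sum>i\<in>S. c i * X_entry L i j)"
      by (simp add: sum_distrib_left ac_simps)
    also have "\<dots> = 0" using col[OF j] by simp
    finally show "(\<Sum>i\<in>S. p i * ?Y i) = 0" by (simp add: Zero_fract_def eq_fract)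
  qed (use assms in auto)
  moreover have "Fract q 1 \<noteq> 0" using q by (simp add: Zero_fract_def eq_fract)
  ultimately show ?thesis
    using p by (metis Zero_fract_def mult_eq_0_iff)
qed

section \<open>The coefficient field of the generic system\<close>

lemma poly_ring_UNIV_mult:
  assumes "p \<in> poly_ring UNIV V" "q \<in> poly_ring UNIV V"
  shows "p * q \<in> poly_ring UNIV V"
proof -
  have "Poly_Mapping.keys m \<subseteq> V" if m: "m \<in> Poly_Mapping.keys (p * q)" for m
  proof -
    obtain a b where "a \<in> Poly_Mapping.keys p" "b \<in> Poly_Mapping.keys q" "m = a + b"
      using m keys_mult[of p q] by blast
    moreover from this assms have "Poly_Mapping.keys a \<subseteq> V" "Poly_Mapping.keys b \<subseteq> V"
      by (auto simp: poly_ring_def)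
    ultimately show ?thesis using keys_add[of a b] by blast
  qed
  then show ?thesis by (simp add: poly_ring_def)
qed

lemma subfield_coeff_field: "subfield (coeff_field n L)"
proof -
  define V where "V = {XVar i j | i j. i \<in> {1..n} \<and> j \<in> {1..n-1} \<and> L i j \<noteq> 0}"
  let ?R = "poly_ring UNIV V :: ((xvar \<Rightarrow>\<^sub>0 nat) \<Rightarrow>\<^sub>0 rat) set"
  have mult: "p * q \<in> ?R" if "p \<in> ?R" "q \<in> ?R" for p q
    using poly_ring_UNIV_mult that by blast
  have diff: "p - q \<in> ?R" if "p \<in> ?R" "q \<in> ?R" for p q
    using that keys_diff[of p q] by (fastforce simp: poly_ring_def)
  have one: "1 \<in> ?R" by (simp add: poly_ring_def)
  have K: "x \<in> coeff_field n L \<longleftrightarrow> (\<exists>p\<in>?R. \<exists>q\<in>?R. q \<noteq> 0 \<and> x = Fract p q)" for x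
    unfolding coeff_field_def V_def[symmetric] Let_def by blast
  show ?thesis
  proof
    show "1 \<in> coeff_field n L" unfolding K One_fract_def using one one_neq_zero by blast
    fix x y assume "x \<in> coeff_field n L" "y \<in> coeff_field n L"
    then obtain p q r s where *: "p \<in> ?R" "q \<in> ?R" "q \<noteq> 0" "x = Fract p q"
      "r \<in> ?R" "s \<in> ?R" "s \<noteq> 0" "y = Fract r s" unfolding K by blast
    have "x - y = Fract (p * s - r * q) (q * s)" "x * y = Fract (p * r) (q * s)"
      using * by simp_all
    moreover have "q * s \<noteq> 0" using * by simp
    ultimately show "x - y \<in> coeff_field n L" "x * y \<in> coeff_field n L"
      unfolding K using mult diff * by blast+
  next
    fix x assume "x \<in> coeff_field n L"
    then obtain p q where *: "p \<in> ?R" "q \<in> ?R" "q \<noteq> 0" "x = Fract p q" unfolding K by blast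
    show "inverse x \<in> coeff_field n L"
    proof (cases "p = 0")
      \<comment> \<open>The fraction \<open>Fract q p\<close> is not admissible for
        \<open>p = 0\<close>; there \<open>x\<close> is zero and equals its own inverse.\<close>
      case True
      then have "inverse x = x" using * by (simp add: eq_fract Zero_fract_def)
      with * show ?thesis unfolding K by metis
    next
      case False
      then show ?thesis unfolding K using * by (metis inverse_fract)
    qed
  qed
qed

lemma X_entry_in_coeff_field:
  assumes "i \<in> {1..n}" "j \<in> {1..n-1}"
  shows "X_entry L i j \<in> coeff_field n L"
proof (cases "L i j = 0")
  case True
  interpret subfield "coeff_field n L" by (rule subfield_coeff_field)
  from True show ?thesis by (simp add: X_entry_def zero_closed)
next
  case False
  let ?R = "poly_ring UNIV {XVar i j | i j. i \<in> {1..n} \<and> j \<in> {1..n-1} \<and> L i j \<noteq> 0}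
     :: ((xvar \<Rightarrow>\<^sub>0 nat) \<Rightarrow>\<^sub>0 rat) set"
  have "mvar (XVar i j) \<in> ?R" "1 \<in> ?R"
    using assms False by (auto simp: poly_ring_def mvar_def)
  then show ?thesis
    using False unfolding X_entry_def coeff_field_def Let_def
    by simp (metis one_neq_zero)
qed

section \<open>Reduced Groebner bases of linear ideals\<close>

lemma zero_le_monomial: "0 \<le> (k :: 'v::linorder \<Rightarrow>\<^sub>0 nat)"
proof (cases "k = 0")
  case False
  then have ne: "Poly_Mapping.keys k \<noteq> {}" by simp
  let ?v = "Min (Poly_Mapping.keys k)"
  have "?v \<in> Poly_Mapping.keys k" using ne by (intro Min_in) auto
  moreover have "Poly_Mapping.lookup k w = 0" if "w < ?v" for w
    using that by (metis Min_le finite_keys in_keys_iff leD)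
  ultimately have "0 < k"
    unfolding monomial_less_iff by (intro exI[of _ ?v]) (auto simp: in_keys_iff)
  then show ?thesis by simp
qed simp

lemma mono_dvd_le: "mono_dvd m m' \<Longrightarrow> m \<le> (m' :: 'v::linorder \<Rightarrow>\<^sub>0 nat)"
  unfolding mono_dvd_def by (metis add.right_neutral add_left_mono zero_le_monomial)

lemma mono_dvd_trans: "mono_dvd a b \<Longrightarrow> mono_dvd b c \<Longrightarrow> mono_dvd a c"
  unfolding mono_dvd_def by (metis add.assoc)

lemma lead_mon_in_keys: "p \<noteq> 0 \<Longrightarrow> lead_mon p \<in> Poly_Mapping.keys p"
  unfolding lead_mon_def by (intro Max_in) auto

lemma le_lead_mon: "m \<in> Poly_Mapping.keys p \<Longrightarrow> m \<le> lead_mon p"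
  unfolding lead_mon_def by (intro Max_ge) auto

text \<open>Reducedness compares \<open>g\<close> only with the other basis elements; for
  \<open>h = g\<close> the claim holds because a divisor is never larger than its multiple.\<close>

lemma reduced_groebner_basis_key:
  assumes G: "is_reduced_groebner_basis I G" and g: "g \<in> G" "m \<in> Poly_Mapping.keys g"
    "m \<noteq> lead_mon g" and h: "h \<in> G"
  shows "\<not> mono_dvd (lead_mon h) m"
proof (cases "h = g")
  case True
  then show ?thesis using g(3) le_lead_mon[OF g(2)] mono_dvd_le by fastforce
next
  case False
  with assms show ?thesis unfolding is_reduced_groebner_basis_def by blast
qed

lemma reduced_groebner_basis_subset:
  assumes diff: "\<And>p q. p \<in> I \<Longrightarrow> q \<in> I \<Longrightarrow> p - q \<in> I"
    and G: "is_reduced_groebner_basis I G" and G': "is_reduced_groebner_basis I G'"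
  shows "G \<subseteq> G'"
proof
  have divisor: "\<exists>h\<in>H. mono_dvd (lead_mon h) (lead_mon p)"
    if "is_reduced_groebner_basis I H" "p \<in> I" "p \<noteq> 0" for H p
    using that unfolding is_reduced_groebner_basis_def is_groebner_basis_def by blast
  have in_I: "h \<in> I" "h \<noteq> 0" "Poly_Mapping.lookup h (lead_mon h) = 1"
    if "is_reduced_groebner_basis I H" "h \<in> H" for H h
    using that unfolding is_reduced_groebner_basis_def is_groebner_basis_def by blast+
  fix g assume g: "g \<in> G"
  obtain g' where g': "g' \<in> G'" "mono_dvd (lead_mon g') (lead_mon g)"
    using divisor[OF G' in_I(1,2)[OF G g]] by blast
  obtain g'' where g'': "g'' \<in> G" "mono_dvd (lead_mon g'') (lead_mon g')"
    using divisor[OF G in_I(1,2)[OF G' g'(1)]] by blast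
  \<comment> \<open>By transitivity \<open>lead_mon g''\<close> divides \<open>lead_mon g\<close>, a
    monomial of \<open>g\<close>, which reducedness of \<open>G\<close> permits only for
    \<open>g'' = g\<close>. The leading monomials of \<open>g\<close> and \<open>g'\<close> then
    divide each other.\<close>
  have "g'' = g"
    using mono_dvd_trans[OF g''(2) g'(2)] g g''(1) lead_mon_in_keys[OF in_I(2)[OF G g]] G
    unfolding is_reduced_groebner_basis_def by blast
  then have lead: "lead_mon g' = lead_mon g"
    using g'(2) g''(2) by (metis mono_dvd_le order_antisym)
  have "g - g' = 0"
  proof (rule ccontr)
    assume ne: "g - g' \<noteq> 0"
    let ?m = "lead_mon (g - g')"
    have m: "?m \<in> Poly_Mapping.keys (g - g')" using lead_mon_in_keys[OF ne] .
    \<comment> \<open>Both elements are monic, so their leading terms cancel. What leads the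
      difference is a non-leading monomial of \<open>g\<close> or of \<open>g'\<close>, yet as the
      leading monomial of an ideal element it is divisible by a leading monomial from each
      basis.\<close>
    have m_ne: "?m \<noteq> lead_mon g"
      using m in_I(3)[OF G g] in_I(3)[OF G' g'(1)] lead by (auto simp: in_keys_iff lookup_minus)
    have I: "g - g' \<in> I" using diff in_I(1) G g G' g'(1) by blast
    obtain h where h: "h \<in> G" "mono_dvd (lead_mon h) ?m" using divisor[OF G I ne] by blast
    obtain h' where h': "h' \<in> G'" "mono_dvd (lead_mon h') ?m" using divisor[OF G' I ne] by blast
    have "?m \<in> Poly_Mapping.keys g \<or> ?m \<in> Poly_Mapping.keys g'"
      using m keys_diff[of g g'] by blast
    then show False
      using reduced_groebner_basis_key[OF G g _ m_ne h(1)] h(2)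
        reduced_groebner_basis_key[OF G' g'(1) _ _ h'(1)] h'(2) m_ne lead by metis
  qed
  then show "g \<in> G'" using g'(1) by simp
qed

lemma reduced_groebner_basis_eqI:
  assumes "\<And>p q. p \<in> I \<Longrightarrow> q \<in> I \<Longrightarrow> p - q \<in> I" and "is_reduced_groebner_basis I G"
  shows "reduced_groebner_basis I = G"
  unfolding reduced_groebner_basis_def
proof (intro the_equality assms(2))
  fix G' assume "is_reduced_groebner_basis I G'"
  with assms show "G' = G" by (intro subset_antisym reduced_groebner_basis_subset[of I])
qed

section \<open>Ideals and polynomial rings with restricted coefficients\<close>

text \<open>Padding with zero coefficients puts all members over the same finite index set, so they
  can be handled termwise.\<close>

lemma ideal_in_iff:
  assumes "finite S" "0 \<in> R"
  shows "p \<in> ideal_in R S \<longleftrightarrow> (\<exists>q. (\<forall>g\<in>S. q g \<in> R) \<and> p = (\<Sum>g\<in>S. q g * g))"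
proof
  assume "p \<in> ideal_in R S"
  then obtain F q where Fq: "finite F" "F \<subseteq> S" "\<forall>g\<in>F. q g \<in> R" "p = (\<Sum>g\<in>F. q g * g)"
    unfolding ideal_in_def by blast
  let ?q = "\<lambda>g. if g \<in> F then q g else 0"
  have "(\<Sum>g\<in>F. q g * g) = (\<Sum>g\<in>S. ?q g * g)"
    using Fq assms by (intro sum.mono_neutral_cong_left) auto
  moreover have "\<forall>g\<in>S. ?q g \<in> R" using Fq assms by auto
  ultimately show "\<exists>q. (\<forall>g\<in>S. q g \<in> R) \<and> p = (\<Sum>g\<in>S. q g * g)"
    unfolding Fq(4) by (intro exI[of _ ?q] conjI)
next
  assume "\<exists>q. (\<forall>g\<in>S. q g \<in> R) \<and> p = (\<Sum>g\<in>S. q g * g)"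
  then show "p \<in> ideal_in R S" unfolding ideal_in_def using assms by blast
qed

lemma ideal_in_diff:
  assumes "finite S" "0 \<in> R" and diff: "\<And>p q. p \<in> R \<Longrightarrow> q \<in> R \<Longrightarrow> p - q \<in> R"
    and "x \<in> ideal_in R S" "y \<in> ideal_in R S"
  shows "x - y \<in> ideal_in R S"
proof -
  obtain q r where "\<forall>g\<in>S. q g \<in> R" "x = (\<Sum>g\<in>S. q g * g)"
    "\<forall>g\<in>S. r g \<in> R" "y = (\<Sum>g\<in>S. r g * g)"
    using assms(4,5) unfolding ideal_in_iff[OF assms(1,2)] by blast
  then have "(\<forall>g\<in>S. q g - r g \<in> R) \<and> x - y = (\<Sum>g\<in>S. (q g - r g) * g)"
    using diff by (simp add: left_diff_distrib sum_subtractf)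
  then show ?thesis unfolding ideal_in_iff[OF assms(1,2)] by (intro exI[of _ "\<lambda>g. q g - r g"])
qed

lemma (in subfield) poly_ring_diff:
  fixes p q :: "('v \<Rightarrow>\<^sub>0 nat) \<Rightarrow>\<^sub>0 'a"
  assumes "p \<in> poly_ring K V" "q \<in> poly_ring K V"
  shows "p - q \<in> poly_ring K V"
proof -
  have *: "Poly_Mapping.lookup r m \<in> K" if "r \<in> poly_ring K V" for r m
    using that zero_closed
    by (cases "m \<in> Poly_Mapping.keys r") (auto simp: poly_ring_def in_keys_iff)
  have "Poly_Mapping.keys m \<subseteq> V" if "m \<in> Poly_Mapping.keys (p - q)" for m
    using that keys_diff[of p q] assms unfolding poly_ring_def by blast
  then show ?thesis
    unfolding poly_ring_def using *[OF assms(1)] *[OF assms(2)]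
    by (simp add: lookup_minus diff_closed)
qed

lemma (in subfield) mconst_in_poly_ring: "c \<in> K \<Longrightarrow> mconst c \<in> poly_ring K V"
  by (simp add: poly_ring_def mconst_def)

lemma mconst_0: "mconst 0 = 0"
  by (simp add: mconst_def)

lemma mconst_add: "mconst (b + c) = mconst b + mconst c"
  by (simp add: mconst_def single_add)

lemma mconst_mult: "mconst (b * c) = mconst b * mconst c"
  by (simp add: mconst_def mult_single)

lemma lookup_mconst_mult:
  "Poly_Mapping.lookup (mconst c * p) m = c * Poly_Mapping.lookup p m"
  by (induction p rule: poly_mapping_single_induct)
     (auto simp: distrib_left lookup_add mconst_def mult_single lookup_single when_def)

section \<open>Substitution homomorphisms\<close>

definition subst_mon :: "('v \<Rightarrow> ('v \<Rightarrow>\<^sub>0 nat) \<Rightarrow>\<^sub>0 'a::comm_ring_1) \<Rightarrow> ('v \<Rightarrow>\<^sub>0 nat) \<Rightarrow> ('v \<Rightarrow>\<^sub>0 nat) \<Rightarrow>\<^sub>0 'a"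
  where "subst_mon s m = (\<Prod>v\<in>Poly_Mapping.keys m. s v ^ Poly_Mapping.lookup m v)"

definition subst_poly ::
    "('v \<Rightarrow> ('v \<Rightarrow>\<^sub>0 nat) \<Rightarrow>\<^sub>0 'a::comm_ring_1) \<Rightarrow> (('v \<Rightarrow>\<^sub>0 nat) \<Rightarrow>\<^sub>0 'a) \<Rightarrow> ('v \<Rightarrow>\<^sub>0 nat) \<Rightarrow>\<^sub>0 'a" where
  "subst_poly s p = (\<Sum>m\<in>Poly_Mapping.keys p. mconst (Poly_Mapping.lookup p m) * subst_mon s m)"

lemma subst_mon_superset:
  assumes "finite V" "Poly_Mapping.keys m \<subseteq> V"
  shows "subst_mon s m = (\<Prod>v\<in>V. s v ^ Poly_Mapping.lookup m v)"
  unfolding subst_mon_def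
  by (rule prod.mono_neutral_left) (use assms in \<open>auto simp: in_keys_iff\<close>)

lemma subst_mon_add: "subst_mon s (m + m') = subst_mon s m * subst_mon s m'"
proof -
  let ?V = "Poly_Mapping.keys m \<union> Poly_Mapping.keys m'"
  have "finite ?V" by simp
  note superset = subst_mon_superset[OF this, of _ s]
  show ?thesis
    unfolding superset[OF keys_add] superset[OF Un_upper1] superset[OF Un_upper2]
    by (simp add: lookup_add power_add prod.distrib)
qed

lemma subst_mon_var: "subst_mon s (Poly_Mapping.single v 1) = s v"
  by (simp add: subst_mon_def)

lemma subst_poly_superset:
  assumes "finite M" "Poly_Mapping.keys p \<subseteq> M"
  shows "subst_poly s p = (\<Sum>m\<in>M. mconst (Poly_Mapping.lookup p m) * subst_mon s m)"
  unfolding subst_poly_def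
  by (rule sum.mono_neutral_left) (use assms in \<open>auto simp: in_keys_iff mconst_0\<close>)

lemma subst_poly_0: "subst_poly s 0 = 0"
  by (simp add: subst_poly_def)

lemma subst_poly_add: "subst_poly s (p + q) = subst_poly s p + subst_poly s q"
proof -
  let ?M = "Poly_Mapping.keys p \<union> Poly_Mapping.keys q"
  have "finite ?M" by simp
  note superset = subst_poly_superset[OF this, of _ s]
  show ?thesis
    unfolding superset[OF keys_add] superset[OF Un_upper1] superset[OF Un_upper2]
    by (simp add: lookup_add mconst_add distrib_right sum.distrib)
qed

lemma subst_poly_single: "subst_poly s (Poly_Mapping.single m c) = mconst c * subst_mon s m"
  by (cases "c = 0") (simp_all add: subst_poly_def mconst_0)

text \<open>By additivity it suffices to treat two terms, where exponents add. Hence a substitution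
  kills an ideal as soon as it kills the generators.\<close>

lemma subst_poly_mult: "subst_poly s (p * q) = subst_poly s p * subst_poly s q"
proof -
  have s: "subst_poly s (Poly_Mapping.single m c * q) =
      subst_poly s (Poly_Mapping.single m c) * subst_poly s q" for m c
    by (induction q rule: poly_mapping_single_induct)
       (simp_all add: subst_poly_0 distrib_left subst_poly_add mult_single subst_poly_single
          subst_mon_add mconst_mult ac_simps)
  show ?thesis
    by (induction p rule: poly_mapping_single_induct)
       (simp_all add: subst_poly_0 s distrib_right subst_poly_add)
qed

lemma subst_poly_sum: "subst_poly s (\<Sum>i\<in>A. p i) = (\<Sum>i\<in>A. subst_poly s (p i))"
  by (induction A rule: infinite_finite_induct) (simp_all add: subst_poly_0 subst_poly_add)

lemma mult_keys_atMost:
  fixes p q :: "('v::linorder \<Rightarrow>\<^sub>0 nat) \<Rightarrow>\<^sub>0 'a::comm_ring_1"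
  assumes "Poly_Mapping.keys p \<subseteq> {..m}" "Poly_Mapping.keys q \<subseteq> {..m'}"
  shows "Poly_Mapping.keys (p * q) \<subseteq> {..m + m'}"
  using keys_mult[of p q] assms by (fastforce intro: add_mono)

lemma monomial_expansion:
  "(\<Sum>v\<in>Poly_Mapping.keys m. Poly_Mapping.single v (Poly_Mapping.lookup m v)) = m"
  by (rule poly_mapping_eqI) (auto simp: lookup_sum lookup_single when_def in_keys_iff)

text \<open>The monomial order is compatible with addition, so the bounds on the factors add up to
  \<open>m\<close> itself.\<close>

lemma keys_subst_mon_atMost:
  fixes s :: "'v::linorder \<Rightarrow> ('v \<Rightarrow>\<^sub>0 nat) \<Rightarrow>\<^sub>0 'a::comm_ring_1"
  assumes s: "\<And>v. Poly_Mapping.keys (s v) \<subseteq> {..Poly_Mapping.single v 1}"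
  shows "Poly_Mapping.keys (subst_mon s m) \<subseteq> {..m}"
proof -
  have pow: "Poly_Mapping.keys (s v ^ k) \<subseteq> {..Poly_Mapping.single v k}" for v k
  proof (induction k)
    case (Suc k)
    have "Poly_Mapping.single v 1 + Poly_Mapping.single v k = Poly_Mapping.single v (Suc k)"
      by (simp flip: single_add)
    with mult_keys_atMost[OF s[of v] Suc] show ?case by simp
  qed simp
  have "Poly_Mapping.keys (\<Prod>v\<in>F. s v ^ Poly_Mapping.lookup m v)
      \<subseteq> {..\<Sum>v\<in>F. Poly_Mapping.single v (Poly_Mapping.lookup m v)}" if "finite F" for F
    using that
  proof induction
    case (insert v F)
    show ?case using mult_keys_atMost[OF pow insert.IH] insert.hyps by simp
  qed simp
  from this[of "Poly_Mapping.keys m"] show ?thesis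
    by (simp add: monomial_expansion subst_mon_def)
qed

lemma subst_mon_id:
  fixes s :: "'v \<Rightarrow> ('v \<Rightarrow>\<^sub>0 nat) \<Rightarrow>\<^sub>0 'a::comm_ring_1"
  assumes "\<And>v. v \<in> Poly_Mapping.keys m \<Longrightarrow> s v = mvar v"
  shows "subst_mon s m = Poly_Mapping.single m 1"
proof -
  have pow: "mvar v ^ k = (Poly_Mapping.single (Poly_Mapping.single v k) 1 :: ('v \<Rightarrow>\<^sub>0 nat) \<Rightarrow>\<^sub>0 'a)" for v k
  proof (induction k)
    case (Suc k)
    then show ?case by (simp add: mvar_def mult_single flip: single_add)
  qed simp
  have "(\<Prod>v\<in>F. mvar v ^ Poly_Mapping.lookup m v) =
      (Poly_Mapping.single (\<Sum>v\<in>F. Poly_Mapping.single v (Poly_Mapping.lookup m v)) 1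
        :: ('v \<Rightarrow>\<^sub>0 nat) \<Rightarrow>\<^sub>0 'a)" if "finite F" for F
    using that by induction (simp_all add: pow mult_single)
  from this[of "Poly_Mapping.keys m"] show ?thesis
    using assms by (simp add: subst_mon_def monomial_expansion)
qed

section \<open>Variables as monomials and linear forms\<close>

lemma single_var_eq_iff: "Poly_Mapping.single v (1::nat) = Poly_Mapping.single u 1 \<longleftrightarrow> v = u"
  by (metis lookup_single_eq lookup_single_not_eq zero_neq_one)

lemma single_var_le:
  fixes u v :: "'v::linorder"
  assumes "v \<le> u"
  shows "Poly_Mapping.single u (1::nat) \<le> Poly_Mapping.single v 1"
proof (cases "v = u")
  case False
  with assms have "Poly_Mapping.single u (1::nat) < Poly_Mapping.single v 1"
    unfolding monomial_less_iff by (intro exI[of _ v]) (auto simp: lookup_single when_def)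
  then show ?thesis by simp
qed simp

lemma mono_dvd_single_var: "v \<in> Poly_Mapping.keys m \<Longrightarrow> mono_dvd (Poly_Mapping.single v 1) m"
  unfolding mono_dvd_def
  by (intro exI[of _ "m - Poly_Mapping.single v 1"] poly_mapping_eqI)
     (auto simp: lookup_add lookup_minus lookup_single when_def in_keys_iff)

lemma mono_dvd_single_vars:
  "mono_dvd (Poly_Mapping.single v 1) (Poly_Mapping.single u 1) \<Longrightarrow> v = u"
  unfolding mono_dvd_def
  by (metis add_is_0 lookup_add lookup_single_eq lookup_single_not_eq zero_neq_one)

definition linear_form :: "'v set \<Rightarrow> ('v \<Rightarrow> 'a) \<Rightarrow> ('v \<Rightarrow>\<^sub>0 nat) \<Rightarrow>\<^sub>0 'a::comm_ring_1" where
  "linear_form V w = (\<Sum>v\<in>V. Poly_Mapping.single (Poly_Mapping.single v 1) (w v))"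

lemma lookup_linear_form:
  assumes "finite V" "v \<in> V"
  shows "Poly_Mapping.lookup (linear_form V w) (Poly_Mapping.single v 1) = w v"
proof -
  have "Poly_Mapping.lookup (linear_form V w) (Poly_Mapping.single v 1) = (\<Sum>u\<in>V. if u = v then w u else 0)"
    unfolding linear_form_def lookup_sum lookup_single single_var_eq_iff when_def by simp
  with assms show ?thesis by simp
qed

lemma keys_linear_form:
  assumes "finite V"
  shows "Poly_Mapping.keys (linear_form V w) = (\<lambda>v. Poly_Mapping.single v 1) ` {v \<in> V. w v \<noteq> 0}"
proof -
  have "\<exists>v\<in>V. m = Poly_Mapping.single v 1" if m: "m \<in> Poly_Mapping.keys (linear_form V w)" for m
  proof (rule ccontr)
    assume "\<not> ?thesis"
    then have "Poly_Mapping.lookup (linear_form V w) m = 0"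
      unfolding linear_form_def lookup_sum by (intro sum.neutral) (auto simp: lookup_single when_def)
    with m show False by (simp add: in_keys_iff)
  qed
  moreover have "Poly_Mapping.single v 1 \<in> Poly_Mapping.keys (linear_form V w) \<longleftrightarrow> w v \<noteq> 0"
    if "v \<in> V" for v
    using lookup_linear_form[OF assms that, of w] by (simp add: in_keys_iff)
  ultimately show ?thesis by fast
qed

lemma linear_form_sum:
  "linear_form V (\<lambda>v. \<Sum>i\<in>A. k i * P i v) = (\<Sum>i\<in>A. mconst (k i) * linear_form V (P i))"
  by (rule poly_mapping_eqI, simp add: linear_form_def lookup_sum lookup_mconst_mult lookup_single
        when_def sum_distrib_left if_distrib sum.swap[of _ V] cong: if_cong)
     (auto intro!: sum.cong)

lemma linear_form_diff:
  "linear_form V (\<lambda>v. w v - w' v) = linear_form V w - linear_form V w'"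
  by (simp add: linear_form_def single_diff sum_subtractf)

lemma linear_form_0: "linear_form V (\<lambda>v. 0) = 0"
  by (simp add: linear_form_def)

text \<open>The monomial order reverses the order of the variables, so the first nonzero coordinate
  marks the leading monomial of the linear form.\<close>

definition leading_var :: "('v::linorder \<Rightarrow> 'a::zero) \<Rightarrow> 'v \<Rightarrow> bool" where
  "leading_var w v \<longleftrightarrow> w v \<noteq> 0 \<and> (\<forall>u<v. w u = 0)"

lemma lead_mon_linear_form:
  assumes "finite V" "v \<in> V" "leading_var w v"
  shows "lead_mon (linear_form V w) = Poly_Mapping.single v 1"
  unfolding lead_mon_def keys_linear_form[OF assms(1)]
proof (rule Max_eqI)
  show "Poly_Mapping.single v 1 \<in> (\<lambda>v. Poly_Mapping.single v 1) ` {v \<in> V. w v \<noteq> 0}"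
    using assms by (auto simp: leading_var_def)
  fix m assume "m \<in> (\<lambda>v. Poly_Mapping.single v (1::nat)) ` {v \<in> V. w v \<noteq> 0}"
  then obtain u where u: "w u \<noteq> 0" "m = Poly_Mapping.single u 1" by blast
  then have "v \<le> u" using assms(3) unfolding leading_var_def by (meson not_le_imp_less)
  then show "m \<le> Poly_Mapping.single v 1" using u single_var_le by blast
qed (use assms in simp)

section \<open>Echelon form and Groebner basis of a linear ideal\<close>

text \<open>An ideal is generated by a set, whereas combinations of rows are indexed by
  \<open>A\<close>; \<open>inj_rows\<close> lets one be rewritten as the other.\<close>

locale linear_system = subfield K for K :: "'a::field set" +
  fixes A :: "'i set" and V :: "'v::linorder set" and P :: "'i \<Rightarrow> 'v \<Rightarrow> 'a"
  assumes finite_A: "finite A" and finite_V: "finite V"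
    and P_in: "i \<in> A \<Longrightarrow> P i v \<in> K"
    and P_outside: "i \<in> A \<Longrightarrow> v \<notin> V \<Longrightarrow> P i v = 0"
    and inj_rows: "inj_on (\<lambda>i. linear_form V (P i)) A"
begin

definition row_space :: "('v \<Rightarrow> 'a) set" where
  "row_space = {w. \<exists>k. (\<forall>i\<in>A. k i \<in> K) \<and> w = (\<lambda>v. \<Sum>i\<in>A. k i * P i v)}"

text \<open>These are the pivot columns of the reduced echelon form, described without carrying out
  an elimination.\<close>

definition pivots :: "'v set" where
  "pivots = {v. \<exists>w\<in>row_space. leading_var w v}"

definition row_ideal :: "(('v \<Rightarrow>\<^sub>0 nat) \<Rightarrow>\<^sub>0 'a) set" where
  "row_ideal = ideal_in (poly_ring K V) ((\<lambda>i. linear_form V (P i)) ` A)"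

lemma row_spaceE:
  assumes "w \<in> row_space"
  obtains k where "\<And>i. i \<in> A \<Longrightarrow> k i \<in> K" "w = (\<lambda>v. \<Sum>i\<in>A. k i * P i v)"
  using assms unfolding row_space_def by blast

lemma row_space_in: "w \<in> row_space \<Longrightarrow> w v \<in> K"
  by (elim row_spaceE) (auto intro!: sum_closed mult_closed P_in)

lemma row_space_outside: "w \<in> row_space \<Longrightarrow> v \<notin> V \<Longrightarrow> w v = 0"
  by (elim row_spaceE) (simp add: P_outside)

lemma row_in_row_space:
  assumes "i \<in> A"
  shows "P i \<in> row_space"
proof -
  have "P i v = (\<Sum>r\<in>A. (if r = i then 1 else 0) * P r v)" for v
    using assms finite_A by (simp add: if_distrib[of "\<lambda>x. x * _"] cong: if_cong)
  then show ?thesis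
    unfolding row_space_def
    by (intro CollectI exI[of _ "\<lambda>r. if r = i then 1 else 0"]) (auto simp: closed)
qed

lemma row_space_diff_scale:
  assumes "w \<in> row_space" "w' \<in> row_space" "c \<in> K"
  shows "(\<lambda>v. w v - c * w' v) \<in> row_space"
proof -
  obtain k where k: "\<And>i. i \<in> A \<Longrightarrow> k i \<in> K" "w = (\<lambda>v. \<Sum>i\<in>A. k i * P i v)"
    using assms(1) unfolding row_space_def by blast
  obtain k' where k': "\<And>i. i \<in> A \<Longrightarrow> k' i \<in> K" "w' = (\<lambda>v. \<Sum>i\<in>A. k' i * P i v)"
    using assms(2) unfolding row_space_def by blast
  show ?thesis
    unfolding row_space_def
    by (intro CollectI exI[of _ "\<lambda>i. k i - c * k' i"])
       (auto simp: k k' closed assms left_diff_distrib sum_subtractf sum_distrib_left mult.assoc)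
qed

lemma zero_in_row_space: "(\<lambda>v. 0) \<in> row_space"
  unfolding row_space_def by (intro CollectI exI[of _ "\<lambda>i. 0"]) (auto simp: closed)

lemma row_space_scale: "w \<in> row_space \<Longrightarrow> c \<in> K \<Longrightarrow> (\<lambda>v. c * w v) \<in> row_space"
  using row_space_diff_scale[OF zero_in_row_space, of w "- c"] by (simp add: closed)

lemma ex_leading_var:
  assumes "w \<in> row_space" "w \<noteq> (\<lambda>v. 0)"
  shows "\<exists>v. leading_var w v"
proof -
  let ?S = "{v \<in> V. w v \<noteq> 0}"
  have ne: "?S \<noteq> {}" using assms row_space_outside[OF assms(1)] by auto
  have "Min ?S \<in> ?S" using ne finite_V by (intro Min_in) auto
  moreover have "w u = 0" if "u < Min ?S" for u
  proof (rule ccontr)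
    assume "w u \<noteq> 0"
    then have "u \<in> ?S" using row_space_outside[OF assms(1)] by blast
    then have "Min ?S \<le> u" using finite_V by (intro Min_le) auto
    with that show False by simp
  qed
  ultimately show ?thesis unfolding leading_var_def by blast
qed

text \<open>The leading variable of a nonzero vector would be a pivot at which it does not vanish.
  Row space vectors are therefore determined by their values at the pivots.\<close>

lemma row_space_eq_0:
  assumes "w \<in> row_space" "\<And>v. v \<in> pivots \<Longrightarrow> w v = 0"
  shows "w = (\<lambda>v. 0)"
  using ex_leading_var[OF assms(1)] assms unfolding pivots_def leading_var_def by blast

lemma pivots_subset: "pivots \<subseteq> V"
  unfolding pivots_def leading_var_def using row_space_outside by blast

lemma finite_pivots: "finite pivots"
  using pivots_subset finite_V finite_subset by blast

text \<open>A vector led by \<open>v\<close> is scaled to be monic and then cleared at the later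
  pivots in increasing order; at earlier pivots it vanishes already.\<close>

lemma ex_echelon_row:
  assumes "v \<in> pivots"
  shows "\<exists>g\<in>row_space. g v = 1 \<and> (\<forall>u<v. g u = 0) \<and> (\<forall>u\<in>pivots - {v}. g u = 0)"
proof -
  obtain w where w: "w \<in> row_space" "leading_var w v" using assms unfolding pivots_def by blast
  have "\<exists>g\<in>row_space. g v = 1 \<and> (\<forall>u<v. g u = 0) \<and> (\<forall>u\<in>B. g u = 0)"
    if "finite B" "B \<subseteq> {u \<in> pivots. v < u}" for B
    using that
  proof (induction B rule: finite_linorder_max_induct)
    case empty
    let ?g = "\<lambda>u. inverse (w v) * w u"
    have "?g \<in> row_space" using w by (intro row_space_scale inverse_closed row_space_in)
    with w(2) show ?case unfolding leading_var_def by (intro bexI[of _ ?g]) auto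
  next
    case (insert b B)
    then obtain g where g: "g \<in> row_space" "g v = 1" "\<forall>u<v. g u = 0" "\<forall>u\<in>B. g u = 0"
      by auto
    obtain z where z: "z \<in> row_space" "leading_var z b"
      using insert.prems unfolding pivots_def by blast
    \<comment> \<open>As \<open>z\<close> vanishes before \<open>b\<close>, this clears the entry at
      \<open>b\<close> and leaves \<open>v\<close> and the pivots treated so far, all smaller than
      \<open>b\<close>, untouched.\<close>
    let ?g = "\<lambda>u. g u - g b / z b * z u"
    have "?g \<in> row_space"
      using g z by (intro row_space_diff_scale divide_closed row_space_in)
    moreover have "v < b" using insert.prems by blast
    then have "?g v = 1" "\<forall>u<v. ?g u = 0" "\<forall>u\<in>insert b B. ?g u = 0"
      using g z(2) insert.hyps unfolding leading_var_def by auto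
    ultimately show ?case by (intro bexI[of _ ?g] conjI)
  qed
  then obtain g where g: "g \<in> row_space" "g v = 1" "\<forall>u<v. g u = 0"
    "\<forall>u\<in>{u \<in> pivots. v < u}. g u = 0"
    using finite_subset[OF _ finite_pivots, of "{u \<in> pivots. v < u}"] by blast
  then have "\<forall>u\<in>pivots - {v}. g u = 0" using linorder_neqE by blast
  with g show ?thesis by blast
qed

text \<open>The choice is unambiguous: two candidates agree at every pivot, so their difference is
  zero.\<close>

definition echelon_row :: "'v \<Rightarrow> 'v \<Rightarrow> 'a" where
  "echelon_row v = (SOME g. g \<in> row_space \<and> g v = 1 \<and> (\<forall>u<v. g u = 0) \<and> (\<forall>u\<in>pivots - {v}. g u = 0))"

lemma echelon_row:
  assumes "v \<in> pivots"
  shows "echelon_row v \<in> row_space" "echelon_row v v = 1" "\<And>u. u < v \<Longrightarrow> echelon_row v u = 0"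
    "\<And>u. u \<in> pivots \<Longrightarrow> u \<noteq> v \<Longrightarrow> echelon_row v u = 0"
proof -
  have "\<exists>g. g \<in> row_space \<and> g v = 1 \<and> (\<forall>u<v. g u = 0) \<and> (\<forall>u\<in>pivots - {v}. g u = 0)"
    using ex_echelon_row[OF assms] by blast
  from someI_ex[OF this, folded echelon_row_def]
  show "echelon_row v \<in> row_space" "echelon_row v v = 1" "\<And>u. u < v \<Longrightarrow> echelon_row v u = 0"
    "\<And>u. u \<in> pivots \<Longrightarrow> u \<noteq> v \<Longrightarrow> echelon_row v u = 0" by auto
qed

lemma echelon_row_leading: "v \<in> pivots \<Longrightarrow> leading_var (echelon_row v) v"
  using echelon_row unfolding leading_var_def by simp

lemma lead_mon_echelon_row:
  "v \<in> pivots \<Longrightarrow> lead_mon (linear_form V (echelon_row v)) = Poly_Mapping.single v 1"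
  using lead_mon_linear_form finite_V pivots_subset echelon_row_leading by blast

lemma zero_in_poly_ring: "(0 :: ('v \<Rightarrow>\<^sub>0 nat) \<Rightarrow>\<^sub>0 'a) \<in> poly_ring K V"
  by (simp add: poly_ring_def)

lemma row_ideal_diff: "p \<in> row_ideal \<Longrightarrow> q \<in> row_ideal \<Longrightarrow> p - q \<in> row_ideal"
  unfolding row_ideal_def
  using finite_A zero_in_poly_ring poly_ring_diff by (intro ideal_in_diff) auto

lemma linear_form_in_row_ideal:
  assumes "w \<in> row_space"
  shows "linear_form V w \<in> row_ideal"
proof -
  obtain k where k: "\<And>i. i \<in> A \<Longrightarrow> k i \<in> K" "w = (\<lambda>v. \<Sum>i\<in>A. k i * P i v)"
    using assms unfolding row_space_def by blast
  let ?p = "\<lambda>i. linear_form V (P i)"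
  let ?q = "\<lambda>g. mconst (k (the_inv_into A ?p g))"
  have "linear_form V w = (\<Sum>i\<in>A. mconst (k i) * ?p i)" unfolding k(2) by (rule linear_form_sum)
  also have "\<dots> = (\<Sum>g\<in>?p ` A. ?q g * g)"
    using the_inv_into_f_f[OF inj_rows] by (simp add: sum.reindex[OF inj_rows])
  finally have "linear_form V w = (\<Sum>g\<in>?p ` A. ?q g * g)" .
  moreover have "\<forall>g\<in>?p ` A. ?q g \<in> poly_ring K V"
    using k(1) by (auto simp: the_inv_into_f_f[OF inj_rows] intro: mconst_in_poly_ring)
  ultimately show ?thesis
    unfolding row_ideal_def ideal_in_iff[OF finite_imageI[OF finite_A] zero_in_poly_ring]
    by (intro exI[of _ ?q] conjI)
qed

text \<open>Reduction modulo the ideal: a pivot variable is replaced by the combination of later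
  non-pivot variables to which it is congruent.\<close>

definition pivot_subst :: "'v \<Rightarrow> ('v \<Rightarrow>\<^sub>0 nat) \<Rightarrow>\<^sub>0 'a" where
  "pivot_subst v = (if v \<in> pivots then mvar v - linear_form V (echelon_row v) else mvar v)"

lemma keys_pivot_subst: "Poly_Mapping.keys (pivot_subst v) \<subseteq> {..Poly_Mapping.single v 1}"
proof (cases "v \<in> pivots")
  case True
  have "Poly_Mapping.keys (linear_form V (echelon_row v)) \<subseteq> {..Poly_Mapping.single v 1}"
    using le_lead_mon[of _ "linear_form V (echelon_row v)"] lead_mon_echelon_row[OF True] by auto
  moreover have "Poly_Mapping.keys (mvar v) \<subseteq> {..Poly_Mapping.single v 1}"
    by (simp add: mvar_def)
  ultimately show ?thesis
    using True keys_diff[of "mvar v" "linear_form V (echelon_row v)"]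
    unfolding pivot_subst_def by fastforce
qed (simp add: pivot_subst_def mvar_def)

lemma subst_poly_row:
  assumes "w \<in> row_space"
  shows "subst_poly pivot_subst (linear_form V w) = 0"
proof -
  \<comment> \<open>The residue vanishes at every pivot, hence everywhere, which expands
    \<open>w\<close> in the echelon rows with coefficients \<open>w v\<close>. Substituting into the
    form of \<open>w\<close> yields exactly the form of this residue.\<close>
  let ?r = "\<lambda>u. w u - (\<Sum>v\<in>pivots. w v * echelon_row v u)"
  have sum_in: "(\<lambda>u. w u - (\<Sum>v\<in>B. w v * echelon_row v u)) \<in> row_space" if "B \<subseteq> pivots" for B
    using finite_subset[OF that finite_pivots] that
  proof induction
    case empty
    then show ?case using assms by simp
  next
    case (insert b B)
    then have "(\<lambda>u. (w u - (\<Sum>v\<in>B. w v * echelon_row v u)) - w b * echelon_row b u) \<in> row_space"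
      using echelon_row(1) row_space_in[OF assms] by (intro row_space_diff_scale) auto
    with insert.hyps show ?case by (simp add: algebra_simps)
  qed
  have "?r u = 0" if "u \<in> pivots" for u
  proof -
    have "(\<Sum>v\<in>pivots. w v * echelon_row v u) = (\<Sum>v\<in>pivots. if v = u then w v else 0)"
      using echelon_row(2,4) that by (intro sum.cong) auto
    with that show ?thesis using finite_pivots by simp
  qed
  then have r: "?r = (\<lambda>u. 0)" using sum_in[OF order_refl] by (intro row_space_eq_0)
  have "subst_poly pivot_subst (linear_form V w) = (\<Sum>v\<in>V. mconst (w v) * pivot_subst v)"
    unfolding linear_form_def subst_poly_sum subst_poly_single subst_mon_var ..
  also have "\<dots> = (\<Sum>v\<in>V. mconst (w v) * mvar v -
      (if v \<in> pivots then mconst (w v) * linear_form V (echelon_row v) else 0))"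
    by (intro sum.cong) (auto simp: pivot_subst_def right_diff_distrib)
  also have "\<dots> = (\<Sum>v\<in>V. mconst (w v) * mvar v) -
      (\<Sum>v\<in>pivots. mconst (w v) * linear_form V (echelon_row v))"
    using finite_V pivots_subset
    by (simp add: sum_subtractf sum.inter_restrict[symmetric] Int_absorb1)
  also have "(\<Sum>v\<in>V. mconst (w v) * mvar v) = linear_form V w"
    by (simp add: linear_form_def mconst_def mvar_def mult_single)
  also have "(\<Sum>v\<in>pivots. mconst (w v) * linear_form V (echelon_row v)) =
      linear_form V (\<lambda>u. \<Sum>v\<in>pivots. w v * echelon_row v u)"
    by (rule linear_form_sum[symmetric])
  finally show ?thesis using r by (simp add: linear_form_0 flip: linear_form_diff)
qed

lemma subst_poly_row_ideal:
  assumes "p \<in> row_ideal"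
  shows "subst_poly pivot_subst p = 0"
proof -
  obtain q where "p = (\<Sum>g\<in>(\<lambda>i. linear_form V (P i)) ` A. q g * g)"
    using assms
    unfolding row_ideal_def ideal_in_iff[OF finite_imageI[OF finite_A] zero_in_poly_ring] by blast
  then show ?thesis
    using subst_poly_row[OF row_in_row_space]
    by (auto simp: subst_poly_sum subst_poly_mult intro!: sum.neutral)
qed

text \<open>The substitution kills the ideal but fixes monomials without pivot variables, and it never
  increases monomials.\<close>

lemma pivot_in_lead_mon:
  assumes "p \<in> row_ideal" "p \<noteq> 0"
  shows "\<exists>v\<in>pivots. v \<in> Poly_Mapping.keys (lead_mon p)"
proof (rule ccontr)
  assume "\<not> ?thesis"
  then have id: "subst_mon pivot_subst (lead_mon p) = Poly_Mapping.single (lead_mon p) 1"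
    by (intro subst_mon_id) (auto simp: pivot_subst_def)
  have "0 = Poly_Mapping.lookup (subst_poly pivot_subst p) (lead_mon p)"
    using subst_poly_row_ideal[OF assms(1)] by simp
  also have "\<dots> = (\<Sum>m\<in>Poly_Mapping.keys p. Poly_Mapping.lookup p m *
      Poly_Mapping.lookup (subst_mon pivot_subst m) (lead_mon p))"
    by (simp add: subst_poly_def lookup_sum lookup_mconst_mult)
  also have "\<dots> = (\<Sum>m\<in>Poly_Mapping.keys p. if m = lead_mon p then Poly_Mapping.lookup p m else 0)"
  proof (intro sum.cong refl)
    fix m assume m: "m \<in> Poly_Mapping.keys p"
    show "Poly_Mapping.lookup p m * Poly_Mapping.lookup (subst_mon pivot_subst m) (lead_mon p) =
        (if m = lead_mon p then Poly_Mapping.lookup p m else 0)"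
    proof (cases "m = lead_mon p")
      case False
      then have "\<not> lead_mon p \<le> m" using le_lead_mon[OF m] by auto
      then have "lead_mon p \<notin> Poly_Mapping.keys (subst_mon pivot_subst m)"
        using keys_subst_mon_atMost[OF keys_pivot_subst, of m] by auto
      with False show ?thesis by (simp add: in_keys_iff)
    qed (simp add: id)
  qed
  also have "\<dots> = Poly_Mapping.lookup p (lead_mon p)"
    using lead_mon_in_keys[OF assms(2)] by simp
  finally show False using lead_mon_in_keys[OF assms(2)] by (simp add: in_keys_iff)
qed

text \<open>The leading monomials are the pivot variables themselves, and each ideal element has one
  of them in its leading monomial. Basis elements are reduced because an echelon row vanishes at all
  other pivots.\<close>

lemma reduced_groebner_basis_row_ideal:
  "reduced_groebner_basis row_ideal = (\<lambda>v. linear_form V (echelon_row v)) ` pivots"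
proof (rule reduced_groebner_basis_eqI)
  show "p - q \<in> row_ideal" if "p \<in> row_ideal" "q \<in> row_ideal" for p q
    using that by (rule row_ideal_diff)
  let ?g = "\<lambda>v. linear_form V (echelon_row v)"
  have lookup1: "Poly_Mapping.lookup (?g v) (Poly_Mapping.single v 1) = 1" if "v \<in> pivots" for v
    using that pivots_subset echelon_row(2) by (subst lookup_linear_form[OF finite_V]) auto
  show "is_reduced_groebner_basis row_ideal (?g ` pivots)"
    unfolding is_reduced_groebner_basis_def is_groebner_basis_def
  proof (intro conjI ballI)
    show "finite (?g ` pivots)" using finite_pivots by simp
    show "?g ` pivots \<subseteq> row_ideal - {0}"
    proof safe
      fix v assume v: "v \<in> pivots"
      show "?g v \<in> row_ideal" using v echelon_row(1) by (intro linear_form_in_row_ideal)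
      show False if "?g v = 0" using lookup1[OF v] that by simp
    qed
  next
    fix p assume "p \<in> row_ideal - {0}"
    then obtain v where "v \<in> pivots" "v \<in> Poly_Mapping.keys (lead_mon p)"
      using pivot_in_lead_mon by blast
    then show "\<exists>g\<in>?g ` pivots. mono_dvd (lead_mon g) (lead_mon p)"
      using lead_mon_echelon_row mono_dvd_single_var by fastforce
  next
    fix g assume "g \<in> ?g ` pivots"
    then show "Poly_Mapping.lookup g (lead_mon g) = 1"
      using lead_mon_echelon_row lookup1 by auto
  next
    fix g h m assume g: "g \<in> ?g ` pivots" and h: "h \<in> ?g ` pivots - {g}"
      and m: "m \<in> Poly_Mapping.keys g"
    obtain v where v: "v \<in> pivots" "g = ?g v" using g by blast
    obtain u where u: "u \<in> pivots" "h = ?g u" "u \<noteq> v" using h v by blast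
    obtain z where z: "m = Poly_Mapping.single z 1" "echelon_row v z \<noteq> 0"
      using m unfolding v(2) keys_linear_form[OF finite_V] by blast
    have "z \<noteq> u" using z(2) echelon_row(4)[OF v(1) u(1,3)] by blast
    then show "\<not> mono_dvd (lead_mon h) m"
      using mono_dvd_single_vars[of u z] unfolding u(2) z(1) lead_mon_echelon_row[OF u(1)] by auto
  qed
qed

text \<open>The greatest variable is the smallest monomial, and distinct pivots have distinct
  monomials, so the minimum is attained only at the last pivot.\<close>

lemma arg_min_lead_mon_row_ideal:
  assumes "pivots \<noteq> {}"
  shows "arg_min_on lead_mon (reduced_groebner_basis row_ideal) =
    linear_form V (echelon_row (Max pivots))"
proof -
  let ?g = "\<lambda>v. linear_form V (echelon_row v)"
  let ?a = "arg_min_on lead_mon (?g ` pivots)"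
  have fin: "finite (?g ` pivots)" "?g ` pivots \<noteq> {}" using finite_pivots assms by auto
  obtain v where v: "v \<in> pivots" "?a = ?g v" using arg_min_if_finite(1)[OF fin, of lead_mon] by blast
  have max: "Max pivots \<in> pivots" using finite_pivots assms by (rule Max_in)
  have "lead_mon ?a \<le> lead_mon (?g (Max pivots))"
    using fin max by (intro arg_min_least) auto
  then have "Poly_Mapping.single v (1::nat) \<le> Poly_Mapping.single (Max pivots) 1"
    unfolding v(2) lead_mon_echelon_row[OF v(1)] lead_mon_echelon_row[OF max] .
  moreover have "Poly_Mapping.single (Max pivots) (1::nat) \<le> Poly_Mapping.single v 1"
    using v(1) finite_pivots by (intro single_var_le Max_ge)
  ultimately have "v = Max pivots" by (metis order_antisym single_var_eq_iff)
  with v(2) show ?thesis unfolding reduced_groebner_basis_row_ideal by simp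
qed

end

section \<open>The support of \<open>e\<^sub>0\<close>\<close>

definition uc_vars :: "nat \<Rightarrow> ucvar set" where
  "uc_vars n = CVar ` {1..n} \<union> UVar ` {1..n-1}"

text \<open>Row \<open>i\<close> of a block matrix: an identity block at the \<open>CVar\<close>
  columns and X at the \<open>UVar\<close> columns. Entries with \<open>UVar\<close> index out of
  range are set to \<open>0\<close> to meet \<open>P_outside\<close>.\<close>

definition generic_row :: "nat \<Rightarrow> (nat \<Rightarrow> nat \<Rightarrow> 'a::comm_ring_1 poly) \<Rightarrow> nat \<Rightarrow> ucvar \<Rightarrow> ratfun" where
  "generic_row n L i v = (case v of CVar h \<Rightarrow> if h = i then 1 else 0
     | UVar j \<Rightarrow> if j \<in> {1..n-1} then X_entry L i j else 0)"

lemma generic_row_simps: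
  "generic_row n L i (CVar h) = (if h = i then 1 else 0)"
  "generic_row n L i (UVar j) = (if j \<in> {1..n-1} then X_entry L i j else 0)"
  by (simp_all add: generic_row_def)

lemma linear_form_generic_row:
  assumes "i \<in> {1..n}"
  shows "linear_form (uc_vars n) (generic_row n L i) = generic_poly n L i"
proof -
  let ?m = "\<lambda>v. Poly_Mapping.single (Poly_Mapping.single v (1::nat)) (generic_row n L i v)"
  have "linear_form (uc_vars n) (generic_row n L i) =
      (\<Sum>v\<in>CVar ` {1..n}. ?m v) + (\<Sum>v\<in>UVar ` {1..n-1}. ?m v)"
    unfolding linear_form_def uc_vars_def by (intro sum.union_disjoint) auto
  also have "(\<Sum>v\<in>CVar ` {1..n}. ?m v) = (\<Sum>h\<in>{1..n}. ?m (CVar h))"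
    by (subst sum.reindex) (auto simp: inj_on_def)
  also have "\<dots> = (\<Sum>h\<in>{1..n}. if h = i then mvar (CVar i) else 0)"
    by (intro sum.cong) (auto simp: generic_row_simps mvar_def)
  also have "\<dots> = mvar (CVar i)" using assms by simp
  also have "(\<Sum>v\<in>UVar ` {1..n-1}. ?m v) = (\<Sum>j\<in>{1..n-1}. ?m (UVar j))"
    by (subst sum.reindex) (auto simp: inj_on_def)
  also have "\<dots> = (\<Sum>j=1..n-1. mconst (X_entry L i j) * mvar (UVar j))"
    by (intro sum.cong) (auto simp: generic_row_simps mvar_def mconst_def mult_single)
  finally show ?thesis by (simp add: generic_poly_def)
qed

lemma less_ucvar_simps:
  "UVar j < CVar h" "CVar h < CVar h' \<longleftrightarrow> h < h'"
  by (auto simp: less_ucvar_def)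

lemma linear_system_generic:
  "linear_system (coeff_field n L) {1..n} (uc_vars n) (generic_row n L)"
proof -
  interpret subfield "coeff_field n L" by (rule subfield_coeff_field)
  show ?thesis
  proof
    show fin: "finite (uc_vars n)" by (simp add: uc_vars_def)
    fix i :: nat and v assume i: "i \<in> {1..n}"
    show "generic_row n L i v \<in> coeff_field n L"
      using X_entry_in_coeff_field[OF i] closed by (cases v) (auto simp: generic_row_simps)
    show "generic_row n L i v = 0" if "v \<notin> uc_vars n"
      using i that by (cases v) (auto simp: generic_row_simps uc_vars_def)
  next
    show "inj_on (\<lambda>i. linear_form (uc_vars n) (generic_row n L i)) {1..n}"
    proof (rule inj_onI)
      fix i i' assume i: "i \<in> {1..n}" "i' \<in> {1..n}"
        and eq: "linear_form (uc_vars n) (generic_row n L i) =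
          linear_form (uc_vars n) (generic_row n L i')"
      have "finite (uc_vars n)" "CVar i \<in> uc_vars n" using i by (auto simp: uc_vars_def)
      note lookup = lookup_linear_form[OF this]
      have "generic_row n L i (CVar i) = generic_row n L i' (CVar i)"
        using eq lookup[of "generic_row n L i"] lookup[of "generic_row n L i'"] by simp
      then show "i = i'" by (simp add: generic_row_simps split: if_splits)
    qed
  qed simp
qed

text \<open>Combining the generic rows with such coefficients cancels every \<open>UVar\<close> and
  leaves a linear form in the \<open>CVar\<close>s alone. Values outside \<open>{1..n}\<close> are
  unconstrained.\<close>

definition left_kernel :: "nat \<Rightarrow> (nat \<Rightarrow> nat \<Rightarrow> 'a::comm_ring_1 poly) \<Rightarrow> (nat \<Rightarrow> ratfun) set" where
  "left_kernel n L = {k. (\<forall>i\<in>{1..n}. k i \<in> coeff_field n L) \<and>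
     (\<forall>j\<in>{1..n-1}. (\<Sum>i=1..n. k i * X_entry L i j) = 0)}"

lemma ex_left_kernel:
  assumes "T \<subseteq> {1..n}" "finite C" "card C < card T"
    and "\<And>i j. i \<in> T \<Longrightarrow> j \<in> {1..n-1} - C \<Longrightarrow> L i j = 0" and C: "C \<subseteq> {1..n-1}"
  shows "\<exists>k\<in>left_kernel n L. (\<forall>i. i \<notin> T \<longrightarrow> k i = 0) \<and> (\<exists>i. k i \<noteq> 0)"
proof -
  interpret subfield "coeff_field n L" by (rule subfield_coeff_field)
  have "finite T" using assms(1) finite_subset by blast
  then have "\<exists>k. (\<forall>i. k i \<in> coeff_field n L) \<and> (\<forall>i. i \<notin> T \<longrightarrow> k i = 0) \<and> (\<exists>i. k i \<noteq> 0) \<and>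
      (\<forall>j\<in>C. (\<Sum>i\<in>T. k i * X_entry L i j) = 0)"
    using assms(1-3) C by (intro underdetermined_system X_entry_in_coeff_field) auto
  then obtain k where k: "\<And>i. k i \<in> coeff_field n L" "\<And>i. i \<notin> T \<Longrightarrow> k i = 0" "\<exists>i. k i \<noteq> 0"
    "\<And>j. j \<in> C \<Longrightarrow> (\<Sum>i\<in>T. k i * X_entry L i j) = 0"
    by blast
  have "(\<Sum>i=1..n. k i * X_entry L i j) = 0" if j: "j \<in> {1..n-1}" for j
  proof -
    have "(\<Sum>i=1..n. k i * X_entry L i j) = (\<Sum>i\<in>T. k i * X_entry L i j)"
      using assms(1) k(2) by (intro sum.mono_neutral_right) auto
    also have "\<dots> = 0"
    proof (cases "j \<in> C")
      case False
      with j assms(4) show ?thesis by (intro sum.neutral) (simp add: X_entry_def)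
    qed (rule k(4))
    finally show ?thesis .
  qed
  with k show ?thesis unfolding left_kernel_def by blast
qed

text \<open>As the \<open>u\<^sub>j\<close> precede the \<open>c\<^sub>i\<close>, the coefficient vector of \<open>e\<^sub>0\<close> is the left kernel vector of
  \<open>X\<close> whose first nonzero entry comes as late as possible; hence its support is minimal.\<close>

lemma support_e0_minimal:
  assumes "n \<ge> 1"
  shows "\<exists>k\<in>left_kernel n L. support_e0 n L = {i \<in> {1..n}. k i \<noteq> 0}"
    and "support_e0 n L \<noteq> {}"
    and "\<lbrakk>k \<in> left_kernel n L; \<And>i. i \<notin> support_e0 n L \<Longrightarrow> k i = 0; h \<in> support_e0 n L; k h = 0\<rbrakk>
      \<Longrightarrow> k i = 0"
proof -
  interpret linear_system "coeff_field n L" "{1..n}" "uc_vars n" "generic_row n L"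
    by (rule linear_system_generic)
  have ideal: "row_ideal = generic_ideal n L"
  proof -
    have "(\<lambda>i. linear_form (uc_vars n) (generic_row n L i)) ` {1..n} = generic_poly n L ` {1..n}"
      using linear_form_generic_row by (intro image_cong) auto
    then show ?thesis by (simp only: row_ideal_def generic_ideal_def uc_vars_def[symmetric])
  qed
  \<comment> \<open>The identity block lets the coefficients of a combination be read off its
    \<open>CVar\<close> coordinates.\<close>
  have comb: "(\<Sum>i=1..n. k i * generic_row n L i (CVar h)) = k h" if "h \<in> {1..n}" for k h
    using that by (simp add: generic_row_simps if_distrib[of "\<lambda>x. _ * x"] cong: if_cong)
  have kernel_row: "(\<lambda>v. \<Sum>i=1..n. k i * generic_row n L i v) \<in> row_space"
    "(\<Sum>i=1..n. k i * generic_row n L i (UVar j)) = 0" if "k \<in> left_kernel n L" for k j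
    using that unfolding left_kernel_def row_space_def
    by (auto, cases "j \<in> {1..n-1}", auto simp: generic_row_simps)
  \<comment> \<open>With \<open>n\<close> rows against \<open>n - 1\<close> columns a relation
    exists. Its row vector has no \<open>UVar\<close> part, so a \<open>CVar\<close> leads it, and
    the last pivot, being no earlier, is a \<open>CVar\<close> as well.\<close>
  obtain k0 where k0: "k0 \<in> left_kernel n L" "\<And>i. i \<notin> {1..n} \<Longrightarrow> k0 i = 0" "\<exists>i. k0 i \<noteq> 0"
    using ex_left_kernel[of "{1..n}" n "{1..n-1}" L] assms by auto
  let ?w0 = "\<lambda>v. \<Sum>i=1..n. k0 i * generic_row n L i v"
  obtain i0 where "i0 \<in> {1..n}" "k0 i0 \<noteq> 0" using k0 by metis
  then have "?w0 (CVar i0) \<noteq> 0" using comb by simp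
  then have "?w0 \<noteq> (\<lambda>v. 0)" by metis
  then obtain v0 where v0: "leading_var ?w0 v0"
    using ex_leading_var kernel_row(1)[OF k0(1)] by blast
  then have v0_pivot: "v0 \<in> pivots" unfolding pivots_def using kernel_row(1)[OF k0(1)] by blast
  have max: "Max pivots \<in> pivots" using v0_pivot finite_pivots by (intro Max_in) auto
  have "v0 \<le> Max pivots" using v0_pivot finite_pivots by (intro Max_ge)
  moreover obtain h0 where "v0 = CVar h0"
    using v0 kernel_row(2)[OF k0(1)] unfolding leading_var_def by (cases v0) auto
  ultimately obtain h where h: "Max pivots = CVar h" by (cases "Max pivots") auto
  let ?g = "echelon_row (CVar h)"
  have hp: "CVar h \<in> pivots" using max h by simp
  then have h_in: "h \<in> {1..n}" using pivots_subset by (auto simp: uc_vars_def)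
  obtain k where k: "\<And>i. i \<in> {1..n} \<Longrightarrow> k i \<in> coeff_field n L"
    "?g = (\<lambda>v. \<Sum>i=1..n. k i * generic_row n L i v)"
    using echelon_row(1)[OF hp] unfolding row_space_def by blast
  have g_k: "?g (CVar i) = k i" if "i \<in> {1..n}" for i using that unfolding k(2) by (rule comb)
  have k_ker: "k \<in> left_kernel n L"
  proof -
    have "(\<Sum>i=1..n. k i * X_entry L i j) = 0" if "j \<in> {1..n-1}" for j
      using echelon_row(3)[OF hp less_ucvar_simps(1), of j] that
      unfolding k(2) by (simp add: generic_row_simps)
    with k(1) show ?thesis unfolding left_kernel_def by blast
  qed
  have e0: "e0 n L = linear_form (uc_vars n) ?g"
    unfolding e0_def ideal[symmetric] h[symmetric]
    using v0_pivot by (intro arg_min_lead_mon_row_ideal) auto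
  have "Poly_Mapping.lookup (e0 n L) (Poly_Mapping.single (CVar i) 1) = k i" if "i \<in> {1..n}" for i
    unfolding e0 using that g_k[OF that] finite_V
    by (subst lookup_linear_form) (auto simp: uc_vars_def)
  then have supp: "support_e0 n L = {i \<in> {1..n}. k i \<noteq> 0}" unfolding support_e0_def by auto
  then show "\<exists>k\<in>left_kernel n L. support_e0 n L = {i \<in> {1..n}. k i \<noteq> 0}" using k_ker by blast
  have kh: "k h = 1" using g_k[OF h_in] echelon_row(2)[OF hp] by simp
  then show "support_e0 n L \<noteq> {}" using h_in supp by auto
  fix k' r i assume k': "k' \<in> left_kernel n L" "\<And>i. i \<notin> support_e0 n L \<Longrightarrow> k' i = 0"
    and r: "r \<in> support_e0 n L" "k' r = 0"
  let ?w = "\<lambda>v. \<Sum>i=1..n. k' i * generic_row n L i v"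
  \<comment> \<open>The multiple is chosen to cancel the entry at the last pivot
    \<open>CVar h\<close>. As \<open>?z\<close> then vanishes up to there, it vanishes at all
    pivots, so \<open>k'\<close> is a multiple of \<open>k\<close>.\<close>
  let ?z = "\<lambda>v. ?w v - k' h * ?g v"
  have z: "?z \<in> row_space"
    using kernel_row(1)[OF k'(1)] echelon_row(1)[OF hp] k'(1) h_in
    by (intro row_space_diff_scale) (auto simp: left_kernel_def)
  have z_C: "?z (CVar l) = k' l - k' h * k l" if "l \<in> {1..n}" for l
    using that comb g_k by simp
  have z0: "?z v = 0" if "v \<le> CVar h" for v
  proof (cases v)
    case (UVar j)
    then show ?thesis
      using kernel_row(2)[OF k'(1)] echelon_row(3)[OF hp less_ucvar_simps(1)] by simp
  next
    case (CVar l)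
    show ?thesis
    proof (cases "l \<in> {1..n}")
      case False
      then have "v \<notin> uc_vars n" using CVar by (auto simp: uc_vars_def)
      then show ?thesis by (rule row_space_outside[OF z])
    next
      case l: True
      show ?thesis
      proof (cases "l = h")
        case True
        then show ?thesis using z_C[OF l] CVar kh by simp
      next
        case False
        \<comment> \<open>Before \<open>h\<close> the vector \<open>k\<close> vanishes because
          \<open>CVar h\<close> leads \<open>?g\<close>, and \<open>k'\<close> vanishes because its
          support lies within that of \<open>k\<close>.\<close>
        with that CVar have "CVar l < CVar h" by (simp add: less_ucvar_simps)
        then have "k l = 0" using echelon_row(3)[OF hp] g_k[OF l] by simp
        moreover from this have "k' l = 0" using k'(2) supp by blast
        ultimately show ?thesis using z_C[OF l] CVar by simp
      qed
    qed
  qed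
  have z_eq_0: "?z = (\<lambda>v. 0)"
  proof (rule row_space_eq_0[OF z])
    fix v assume "v \<in> pivots"
    then have "v \<le> CVar h" using finite_pivots h by (metis Max_ge)
    then show "?z v = 0" by (rule z0)
  qed
  have multiple: "k' l = k' h * k l" if "l \<in> {1..n}" for l
    using fun_cong[OF z_eq_0, of "CVar l"] unfolding z_C[OF that] by (rule eq_iff_diff_eq_0[THEN iffD2])
  have "k' h = 0" using multiple[of r] r supp by auto
  then show "k' i = 0"
    using multiple k'(2)[of i] supp by (cases "i \<in> {1..n}") auto
qed

section \<open>Matchings of the support into the columns\<close>

definition row_columns :: "nat \<Rightarrow> (nat \<Rightarrow> nat \<Rightarrow> 'a::comm_ring_1 poly) \<Rightarrow> nat \<Rightarrow> nat set" where
  "row_columns n L i = {j \<in> {1..n-1}. L i j \<noteq> 0}"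

lemma support_e0_subset: "support_e0 n L \<subseteq> {1..n}"
  by (auto simp: support_e0_def)

lemma support_e0_matching:
  assumes "n \<ge> 1" "h \<in> support_e0 n L"
  shows "\<exists>\<eta>. inj_on \<eta> (support_e0 n L - {h}) \<and>
    (\<forall>t\<in>support_e0 n L - {h}. \<eta> t \<in> row_columns n L t)"
proof (rule hall_marriage)
  show "finite (support_e0 n L - {h})" using finite_subset[OF support_e0_subset] by auto
  show "finite (row_columns n L i)" for i by (simp add: row_columns_def)
  fix T assume T: "T \<subseteq> support_e0 n L - {h}"
  show "card T \<le> card (\<Union> (row_columns n L ` T))"
  proof (rule ccontr)
    assume "\<not> ?thesis"
    moreover have C: "\<Union> (row_columns n L ` T) \<subseteq> {1..n-1}" by (auto simp: row_columns_def)
    moreover have "T \<subseteq> {1..n}" using T support_e0_subset by blast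
    moreover have "finite (\<Union> (row_columns n L ` T))" using C finite_subset by blast
    moreover have "L i j = 0"
      if "i \<in> T" "j \<in> {1..n-1} - \<Union> (row_columns n L ` T)" for i j
      using that unfolding row_columns_def by blast
    ultimately obtain k i where k: "k \<in> left_kernel n L" "\<And>i. i \<notin> T \<Longrightarrow> k i = 0" "k i \<noteq> 0"
      using ex_left_kernel[of T n "\<Union> (row_columns n L ` T)" L] by auto
    \<comment> \<open>Leaving out \<open>h\<close> matters here: \<open>k\<close> is supported in
      \<open>T\<close> and so vanishes at \<open>h\<close>, which puts it within reach of
      minimality.\<close>
    have "k i = 0"
      by (rule support_e0_minimal(3)[OF assms(1) k(1) _ assms(2)]) (use k(2) T in blast)+
    with k(3) show False by simp
  qed
qed

lemma card_support_e0:
  assumes "n \<ge> 1"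
  shows "card (support_e0 n L) = card (\<Union> (row_columns n L ` support_e0 n L)) + 1"
proof -
  let ?S = "support_e0 n L"
  let ?N = "\<lambda>T. \<Union> (row_columns n L ` T)"
  have finS: "finite ?S" using finite_subset[OF support_e0_subset] by auto
  have finN: "finite (?N T)" for T
    by (rule finite_subset[of _ "{1..n-1}"]) (auto simp: row_columns_def)
  \<comment> \<open>A proper subset of the support misses some \<open>h\<close>, so it satisfies
    Hall's inequality already; only the full support can violate it.\<close>
  have le: "card T \<le> card (?N T)" if h: "h \<in> ?S" and T: "T \<subseteq> ?S - {h}" for h T
  proof -
    obtain \<eta> where \<eta>: "inj_on \<eta> (?S - {h})" "\<forall>t\<in>?S - {h}. \<eta> t \<in> row_columns n L t"
      using support_e0_matching[OF assms h] by blast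
    have "card T = card (\<eta> ` T)" using \<eta>(1) T by (metis card_image inj_on_subset)
    also have "\<dots> \<le> card (?N T)" using \<eta>(2) T finN by (intro card_mono) auto
    finally show ?thesis .
  qed
  have "card (?N ?S) < card ?S"
  proof (rule ccontr)
    assume not_less: "\<not> ?thesis"
    have "\<exists>\<eta>. inj_on \<eta> ?S \<and> (\<forall>t\<in>?S. \<eta> t \<in> row_columns n L t)"
    proof (rule hall_marriage[OF finS])
      show "finite (row_columns n L i)" for i by (simp add: row_columns_def)
      fix T assume T: "T \<subseteq> ?S"
      show "card T \<le> card (?N T)"
      proof (cases "T = ?S")
        case True
        then show ?thesis using not_less by simp
      next
        case False
        then obtain h where "h \<in> ?S" "T \<subseteq> ?S - {h}" using T by blast
        then show ?thesis by (rule le)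
      qed
    qed
    then obtain \<eta> where \<eta>: "inj_on \<eta> ?S" "\<And>t. t \<in> ?S \<Longrightarrow> \<eta> t \<in> row_columns n L t" by blast
    obtain k where k: "k \<in> left_kernel n L" "?S = {i \<in> {1..n}. k i \<noteq> 0}"
      using support_e0_minimal(1)[OF assms] by blast
    have "\<forall>i\<in>?S. k i = 0"
    proof (rule matched_rows_independent[OF finS \<eta>(1)])
      show "L t (\<eta> t) \<noteq> 0" if "t \<in> ?S" for t using \<eta>(2)[OF that] by (simp add: row_columns_def)
      fix j assume "j \<in> \<eta> ` ?S"
      then have "j \<in> {1..n-1}" using \<eta>(2) by (auto simp: row_columns_def)
      then have "0 = (\<Sum>i=1..n. k i * X_entry L i j)" using k(1) by (simp add: left_kernel_def)
      also have "\<dots> = (\<Sum>i\<in>?S. k i * X_entry L i j)"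
        using k(2) by (intro sum.mono_neutral_right) auto
      finally show "(\<Sum>i\<in>?S. k i * X_entry L i j) = 0" ..
    qed
    then show False using k(2) support_e0_minimal(2)[OF assms] by blast
  qed
  moreover obtain h where h: "h \<in> ?S" using support_e0_minimal(2)[OF assms] by blast
  have "card ?S - 1 \<le> card (?N (?S - {h}))" using le[OF h order_refl] h finS by simp
  moreover have "card (?N (?S - {h})) \<le> card (?N ?S)" using finN by (intro card_mono) auto
  ultimately show ?thesis by linarith
qed

lemma support_e0_bij:
  assumes "n \<ge> 1" "h \<in> support_e0 n L"
  shows "\<exists>\<eta>. bij_betw \<eta> (support_e0 n L - {h}) (\<Union> (row_columns n L ` support_e0 n L)) \<and>
    (\<forall>t\<in>support_e0 n L - {h}. L t (\<eta> t) \<noteq> 0)"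
proof -
  let ?S = "support_e0 n L"
  let ?J = "\<Union> (row_columns n L ` ?S)"
  obtain \<eta> where \<eta>: "inj_on \<eta> (?S - {h})" "\<forall>t\<in>?S - {h}. \<eta> t \<in> row_columns n L t"
    using support_e0_matching[OF assms] by blast
  have "finite ?J" by (rule finite_subset[of _ "{1..n-1}"]) (auto simp: row_columns_def)
  moreover have "\<eta> ` (?S - {h}) \<subseteq> ?J" using \<eta>(2) by blast
  \<comment> \<open>An injection between finite sets of equal size is onto, so the matching exhausts
    the columns \<open>?J\<close>.\<close>
  moreover have "card (\<eta> ` (?S - {h})) = card ?J"
    using card_support_e0[OF assms(1), of L] assms(2) card_image[OF \<eta>(1)]
      finite_subset[OF support_e0_subset[of n L]] by simp
  ultimately have "\<eta> ` (?S - {h}) = ?J" by (intro card_subset_eq)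
  with \<eta> show ?thesis unfolding bij_betw_def row_columns_def by blast
qed

section \<open>From matchings to super essential systems\<close>

text \<open>Without row \<open>i\<close> the rows are numbered from the bottom: rows below
  \<open>i\<close> take the positions \<open>1\<close> to \<open>n - i\<close>, rows above it the
  positions \<open>n - i + 1\<close> to \<open>n - 1\<close>. The required permutation is the
  matching read in these positions.\<close>

lemma super_essentialI:
  fixes L :: "nat \<Rightarrow> nat \<Rightarrow> 'a::comm_ring_1 poly"
  assumes "\<And>h. h \<in> {1..n} \<Longrightarrow> \<exists>\<eta>. bij_betw \<eta> ({1..n} - {h}) {1..n-1} \<and> (\<forall>t\<in>{1..n} - {h}. L t (\<eta> t) \<noteq> 0)"
  shows "super_essential n L"
  unfolding super_essential_def
proof
  fix i assume i: "i \<in> {1..n}"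
  then obtain \<eta> where \<eta>: "bij_betw \<eta> ({1..n} - {i}) {1..n-1}"
    "\<And>t. t \<in> {1..n} - {i} \<Longrightarrow> L t (\<eta> t) \<noteq> 0" using assms by blast
  \<comment> \<open>the inverse of the re-indexing \<open>j \<mapsto> n - j\<close> for \<open>j < i\<close>, \<open>j \<mapsto> n - j + 1\<close> for \<open>j > i\<close>\<close>
  define \<sigma> where "\<sigma> l = (if l \<le> n - i then n + 1 - l else n - l)" for l
  define \<tau> where "\<tau> l = (if l \<in> {1..n-1} then \<eta> (\<sigma> l) else l)" for l
  let ?g = "\<lambda>j. if j < i then n - j else n - j + 1"
  have \<sigma>: "\<sigma> l \<in> {1..n} - {i}" "?g (\<sigma> l) = l" if "l \<in> {1..n-1}" for l
    using that i by (cases "l \<le> n - i"; auto simp: \<sigma>_def)+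
  have g: "?g j \<in> {1..n-1}" "\<sigma> (?g j) = j" if "j \<in> {1..n} - {i}" for j
    using that i by (cases "j < i"; auto simp: \<sigma>_def)+
  have "bij_betw \<sigma> {1..n-1} ({1..n} - {i})"
    by (rule bij_betwI[where g = ?g]) (use \<sigma> g in blast)+
  then have "bij_betw (\<eta> \<circ> \<sigma>) {1..n-1} {1..n-1}" using \<eta>(1) by (rule bij_betw_trans)
  moreover have "bij_betw \<tau> {1..n-1} {1..n-1} \<longleftrightarrow> bij_betw (\<eta> \<circ> \<sigma>) {1..n-1} {1..n-1}"
    by (intro bij_betw_cong) (simp add: \<tau>_def)
  ultimately have "bij_betw \<tau> {1..n-1} {1..n-1}" by blast
  then have "\<tau> permutes {1..n-1}" by (intro bij_imp_permutes) (auto simp: \<tau>_def)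
  moreover have "L j (\<tau> (n - j)) \<noteq> 0" if "j \<in> {1..<i}" for j
  proof -
    have "n - j \<in> {1..n-1}" "\<sigma> (n - j) = j" using that i by (auto simp: \<sigma>_def)
    then show ?thesis using \<eta>(2)[of j] that i by (simp add: \<tau>_def)
  qed
  moreover have "L j (\<tau> (n - j + 1)) \<noteq> 0" if "j \<in> {i+1..n}" for j
  proof -
    have "n - j + 1 \<in> {1..n-1}" "\<sigma> (n - j + 1) = j" using that i by (auto simp: \<sigma>_def)
    then show ?thesis using \<eta>(2)[of j] that i by (simp add: \<tau>_def)
  qed
  ultimately show "\<exists>\<tau>. \<tau> permutes {1..n-1} \<and> (\<forall>j\<in>{1..<i}. L j (\<tau> (n - j)) \<noteq> 0) \<and>
      (\<forall>j\<in>{i+1..n}. L j (\<tau> (n - j + 1)) \<noteq> 0)" by blast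
qed

theorem theorem4p8:
  fixes d :: "'a::idom \<Rightarrow> 'a"
    and n :: nat
    and a :: "nat \<Rightarrow> 'a"
    and L :: "nat \<Rightarrow> nat \<Rightarrow> 'a poly"
    and f :: "nat \<Rightarrow> 'a diffpoly"
  assumes "derivation d"
    and "n \<ge> 2"
    and f: "\<And>i. i \<in> {1..n} \<Longrightarrow> f i = lin_diffpoly d n a L i"
    and P1: "\<And>i. i \<in> {1..n} \<Longrightarrow> f i \<notin> range mconst"
    and P2: "inj_on f {1..n}"
    and P3: "\<exists>i\<in>{1..n}. a i \<noteq> 0"
    and P4: "nu n f L (f ` {1..n}) = n - 1"
    and "\<not> super_essential n L"
  shows "P_star n f L \<subset> f ` {1..n}
    \<and> super_essential_subsystem n f L (P_star n f L)
    \<and> nu n f L (P_star n f L) = card (P_star n f L) - 1"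
proof -
  have n: "n \<ge> 1" using \<open>n \<ge> 2\<close> by simp
  let ?S = "support_e0 n L"
  let ?J = "\<Union> (row_columns n L ` ?S)"
  note S = support_e0_subset[of n L]
  have "?S \<noteq> {1..n}"
  proof
    assume full: "?S = {1..n}"
    have "card ?J = n - 1" using card_support_e0[OF n, of L] full by simp
    then have "?J = {1..n-1}" by (intro card_subset_eq) (auto simp: row_columns_def)
    then have "super_essential n L"
      using support_e0_bij[OF n, of _ L] full by (intro super_essentialI) simp
    with \<open>\<not> super_essential n L\<close> show False ..
  qed
  then have "P_star n f L \<subset> f ` {1..n}"
    unfolding P_star_def using S inj_on_image_eq_iff[OF P2 S order_refl] by blast
  \<comment> \<open>Injectivity of \<open>f\<close> recovers the index set from the set of
    polynomials, so conditions on the subsystem become conditions on \<open>?S\<close>.\<close>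
  moreover have H: "{i \<in> {1..n}. f i \<in> P_star n f L} = ?S"
    unfolding P_star_def using S inj_onD[OF P2] by blast
  moreover have card: "card (P_star n f L) = card ?S"
    unfolding P_star_def using S P2 by (intro card_image) (rule inj_on_subset)
  moreover have "super_essential_subsystem n f L (P_star n f L)"
    unfolding super_essential_subsystem_def Let_def H
  proof (intro conjI exI[of _ ?J] ballI)
    show "P_star n f L \<subseteq> f ` {1..n}" unfolding P_star_def using S by blast
    show "?J \<subseteq> {1..n-1}" by (auto simp: row_columns_def)
    show "card (P_star n f L) = card ?J + 1" unfolding card by (rule card_support_e0[OF n])
    show "L h j = 0" if "h \<in> ?S" "j \<in> {1..n-1} - ?J" for h j
      using that unfolding row_columns_def by blast
    show "\<exists>\<eta>. bij_betw \<eta> (?S - {h}) ?J \<and> (\<forall>t\<in>?S - {h}. L t (\<eta> t) \<noteq> 0)" if "h \<in> ?S" for h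
      using that by (rule support_e0_bij[OF n])
  qed
  moreover have "nu n f L (P_star n f L) = card (P_star n f L) - 1"
  proof -
    have "{j \<in> {1..n-1}. \<exists>i\<in>{1..n}. f i \<in> P_star n f L \<and> L i j \<noteq> 0} = ?J"
      using H unfolding row_columns_def by blast
    then show ?thesis unfolding nu_def card using card_support_e0[OF n, of L] by simp
  qed
  ultimately show ?thesis by blast
qed

end
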